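(* Let $(X_n,b_n)_{n\in\mathbb{N}}$ be a sequence of pointed (proper) locally finite piecewise-$\ell_\infty$ cubings converging, in the sense of pointed Gromov--Hausdorff convergence, to a pointed complete metric space $(X,b)$. Then $X$ is an injective metric space.
   Context: **Injective spaces.** A metric space $X$ is injective if for every isometric embedding $i:A\to C$ of metric spaces and every non-expansive (1-Lipschitz) map $f:A\to X$ there is a non-expansive map $F:C\to X$ with $F\circ i=f$. **Pointed Gromov--Hausdorff convergence.** For $\epsilon>0$, an $\epsilon$-approximation between metric spaces $X,Y$ is a relation $R\subseteq X\times Y$ whose projections to $X$ and to $Y$ are $\epsilon$-dense (closed balls of radius $\epsilon$ about their points cover) and such that $|d(x,x')-d(y,y')|<\epsilon$ for all $(x,y),(x',y')\in R$. A sequence $X_n$ converges to $X$ in the Gromov--Hausdorff sense if for every $\epsilon>0$ there is $N$ such that for all $n\ge N$ there is an $\epsilon$-approximation between $X_n$ and $X$. A sequence $(X_n,b_n)$ of pointed proper metric spaces (closed bounded subsets compact) converges to $(X,b)$ in the pointed sense if for every $R>0$ the closed balls $B_{X_n}(b_n,R)$ converge in the Gromov--Hausdorff sense to the closed ball $B_X(b,R)$. **Poc sets and duals.** A poc set is a partially ordered set $(P,\le)$ with a minimum $0$ and an order-reversing involution $a\mapsto a^*$ such that $a\le a^*$ implies $a=0$. Elements other than $0,0^*$ are proper. $P$ is discrete if $\{x: a\le x\le b\}$ is finite for all proper $a,b$. An ultrafilter on $P$ is a subset $U\subseteq P$ containing exactly one of $a,a^*$ for each $a\in P$ and such that there are no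 $a,b\in U$ with $a\le b^*$. $P^\circ$ is the set of ultrafilters. The cube complex $\mathtt{Cube}(P)$ has vertex set $P^\circ$ and, for every $U\in P^\circ$ and every finite set $A\subseteq U$ of proper elements such that $(U\setminus A')\cup\{a^*:a\in A'\}\in P^\circ$ for all $A'\subseteq A$, a cube of dimension $|A|$ whose vertices are these $2^{|A|}$ ultrafilters. For $B\in P^\circ$, $\mathtt{Cube}(P)_B$ is the connected component containing $B$; its vertices are the $U\in P^\circ$ with $U\setminus B$ finite. **Piecewise-$\ell_\infty$ cubings.** A non-degenerate weight is a function $w:P\to[0,\infty)$ with $w(0)=0$, $w(a^* )=w(a)$ for all $a$, and $w(a)>0$ for proper $a$. Let $\rho_w(U)=w\cdot\chi_{B\setminus U}\in\mathbb{R}^B$ for vertices $U$, extended affinely to every cube (so a cube goes to an axis-parallel box), and let $\mathtt{Cube}_w(P)_B\subset\mathbb{R}^B$ be the image of $\mathtt{Cube}(P)_B$; its faces are the images of cubes. A piecewise-$\ell_\infty$ cubing is a space of the form $\mathtt{Cube}_w(P)_B$ ($P$ a discrete poc set, $w$ a non-degenerate weight, $B\in P^\circ$) with the quotient metric: the distance from $x$ to $y$ is the infimum of $\sum_{i=1}^m\|x_i-x_{i-1}\|_\infty$ over finite sequences $x=x_0,\dots,x_m=y$ of points such that each consecutive pair lies in a common face. It is locally finite if each vertex lies in finitely many cubes. *)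

theory Defs
  imports "HOL-Analysis.Analysis"
begin

section \<open>Injective, proper and convergent metric spaces\<close>

definition nonexpansive_on ::
  "'a set \<Rightarrow> ('a \<Rightarrow> 'a \<Rightarrow> real) \<Rightarrow> 'b set \<Rightarrow> ('b \<Rightarrow> 'b \<Rightarrow> real) \<Rightarrow> ('a \<Rightarrow> 'b) \<Rightarrow> bool" where
  "nonexpansive_on A dA B dB f \<longleftrightarrow>
     f \<in> A \<rightarrow> B \<and> (\<forall>x\<in>A. \<forall>y\<in>A. dB (f x) (f y) \<le> dA x y)"

definition isometric_embedding_on ::
  "'a set \<Rightarrow> ('a \<Rightarrow> 'a \<Rightarrow> real) \<Rightarrow> 'b set \<Rightarrow> ('b \<Rightarrow> 'b \<Rightarrow> real) \<Rightarrow> ('a \<Rightarrow> 'b) \<Rightarrow> bool" where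
  "isometric_embedding_on A dA B dB f \<longleftrightarrow>
     f \<in> A \<rightarrow> B \<and> (\<forall>x\<in>A. \<forall>y\<in>A. dB (f x) (f y) = dA x y)"

text \<open>HOL cannot quantify over types inside a definition, so the types carrying the test spaces
  \<open>A\<close> and \<open>C\<close> are parameters. In the conclusion of a theorem, free type variables in these two
  positions are universally quantified, which gives injectivity against all metric spaces.\<close>

definition injective_metric_space ::
  "'a itself \<Rightarrow> 'c itself \<Rightarrow> 'x set \<Rightarrow> ('x \<Rightarrow> 'x \<Rightarrow> real) \<Rightarrow> bool" where
  "injective_metric_space TA TC X d \<longleftrightarrow>
     Metric_space X d \<and>
     (\<forall>(A::'a set) dA (C::'c set) dC i f.
        Metric_space A dA \<longrightarrow> Metric_space C dC \<longrightarrow>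
        isometric_embedding_on A dA C dC i \<longrightarrow> nonexpansive_on A dA X d f \<longrightarrow>
        (\<exists>F. nonexpansive_on C dC X d F \<and> (\<forall>a\<in>A. F (i a) = f a)))"

definition proper_metric_space :: "'x set \<Rightarrow> ('x \<Rightarrow> 'x \<Rightarrow> real) \<Rightarrow> bool" where
  "proper_metric_space X d \<longleftrightarrow>
     Metric_space X d \<and>
     (\<forall>S. closedin (Metric_space.mtopology X d) S \<and> Metric_space.mbounded X d S \<longrightarrow>
          compactin (Metric_space.mtopology X d) S)"

definition dense_within :: "real \<Rightarrow> 'x set \<Rightarrow> ('x \<Rightarrow> 'x \<Rightarrow> real) \<Rightarrow> 'x set \<Rightarrow> bool" where
  "dense_within \<epsilon> X d S \<longleftrightarrow> X \<subseteq> (\<Union>s\<in>S. Metric_space.mcball X d s \<epsilon>)"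

definition eps_approximation ::
  "real \<Rightarrow> 'x set \<Rightarrow> ('x \<Rightarrow> 'x \<Rightarrow> real) \<Rightarrow> 'y set \<Rightarrow> ('y \<Rightarrow> 'y \<Rightarrow> real) \<Rightarrow> ('x \<times> 'y) set \<Rightarrow> bool" where
  "eps_approximation \<epsilon> X dX Y dY R \<longleftrightarrow>
     R \<subseteq> X \<times> Y \<and>
     dense_within \<epsilon> X dX (fst ` R) \<and> dense_within \<epsilon> Y dY (snd ` R) \<and>
     (\<forall>(x, y)\<in>R. \<forall>(x', y')\<in>R. \<bar>dX x x' - dY y y'\<bar> < \<epsilon>)"

definition GH_converges ::
  "(nat \<Rightarrow> 'x set) \<Rightarrow> (nat \<Rightarrow> 'x \<Rightarrow> 'x \<Rightarrow> real) \<Rightarrow> 'y set \<Rightarrow> ('y \<Rightarrow> 'y \<Rightarrow> real) \<Rightarrow> bool" where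
  "GH_converges X dX Y dY \<longleftrightarrow>
     (\<forall>\<epsilon>>0. \<exists>N. \<forall>n\<ge>N. \<exists>R. eps_approximation \<epsilon> (X n) (dX n) Y dY R)"

definition pointed_GH_converges ::
  "(nat \<Rightarrow> 'x set) \<Rightarrow> (nat \<Rightarrow> 'x \<Rightarrow> 'x \<Rightarrow> real) \<Rightarrow> (nat \<Rightarrow> 'x) \<Rightarrow>
   'y set \<Rightarrow> ('y \<Rightarrow> 'y \<Rightarrow> real) \<Rightarrow> 'y \<Rightarrow> bool" where
  "pointed_GH_converges X dX b Y dY c \<longleftrightarrow>
     (\<forall>r>0. GH_converges (\<lambda>n. Metric_space.mcball (X n) (dX n) (b n) r) dX
                         (Metric_space.mcball Y dY c r) dY)"


section \<open>Poc sets and their dual cube complexes\<close>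

record 'p poc =
  elems :: "'p set"
  le_rel :: "('p \<times> 'p) set"
  zero_elem :: 'p
  star :: "'p \<Rightarrow> 'p"

definition poc_set :: "'p poc \<Rightarrow> bool" where
  "poc_set P \<longleftrightarrow>
     partial_order_on (elems P) (le_rel P) \<and>
     zero_elem P \<in> elems P \<and> (\<forall>a\<in>elems P. (zero_elem P, a) \<in> le_rel P) \<and>
     star P \<in> elems P \<rightarrow> elems P \<and> (\<forall>a\<in>elems P. star P (star P a) = a) \<and>
     (\<forall>a b. (a, b) \<in> le_rel P \<longrightarrow> (star P b, star P a) \<in> le_rel P) \<and>
     (\<forall>a\<in>elems P. (a, star P a) \<in> le_rel P \<longrightarrow> a = zero_elem P)"

definition proper_elems :: "'p poc \<Rightarrow> 'p set" where
  "proper_elems P = elems P - {zero_elem P, star P (zero_elem P)}"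

definition discrete_poc_set :: "'p poc \<Rightarrow> bool" where
  "discrete_poc_set P \<longleftrightarrow>
     poc_set P \<and>
     (\<forall>a\<in>proper_elems P. \<forall>b\<in>proper_elems P.
        finite {x \<in> elems P. (a, x) \<in> le_rel P \<and> (x, b) \<in> le_rel P})"

definition ultrafilters :: "'p poc \<Rightarrow> 'p set set" where
  "ultrafilters P =
     {U. U \<subseteq> elems P \<and> (\<forall>a\<in>elems P. (a \<in> U) \<noteq> (star P a \<in> U)) \<and>
         \<not> (\<exists>a\<in>U. \<exists>b\<in>U. (a, star P b) \<in> le_rel P)}"

definition flip :: "'p poc \<Rightarrow> 'p set \<Rightarrow> 'p set \<Rightarrow> 'p set" where
  "flip P U A = (U - A) \<union> star P ` A"

definition spans_cube :: "'p poc \<Rightarrow> 'p set \<Rightarrow> 'p set \<Rightarrow> bool" where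
  "spans_cube P U A \<longleftrightarrow>
     U \<in> ultrafilters P \<and> finite A \<and> A \<subseteq> U \<and> A \<subseteq> proper_elems P \<and>
     (\<forall>A'\<subseteq>A. flip P U A' \<in> ultrafilters P)"

text \<open>The same cube arises from each of its vertices, so cubes are identified with their
  vertex sets.\<close>

definition cubes :: "'p poc \<Rightarrow> 'p set set set" where
  "cubes P = {flip P U ` Pow A | U A. spans_cube P U A}"

definition component :: "'p poc \<Rightarrow> 'p set \<Rightarrow> 'p set set" where
  "component P B = {U. (B, U) \<in> {(V, W). \<exists>C\<in>cubes P. V \<in> C \<and> W \<in> C}\<^sup>*}"


section \<open>Piecewise sup-norm cubings\<close>

definition nondegenerate_weight :: "'p poc \<Rightarrow> ('p \<Rightarrow> real) \<Rightarrow> bool" where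
  "nondegenerate_weight P w \<longleftrightarrow>
     (\<forall>a\<in>elems P. 0 \<le> w a) \<and> w (zero_elem P) = 0 \<and>
     (\<forall>a\<in>elems P. w (star P a) = w a) \<and> (\<forall>a\<in>proper_elems P. 0 < w a)"

text \<open>Elements of \<open>\<real>\<^sup>B\<close> are represented by functions on the whole type that vanish off \<open>B\<close>.\<close>

definition rho :: "('p \<Rightarrow> real) \<Rightarrow> 'p set \<Rightarrow> 'p set \<Rightarrow> 'p \<Rightarrow> real" where
  "rho w B U = (\<lambda>p. w p * indicator (B - U) p)"

text \<open>The affine map on the cube \<open>[0,1]\<^sup>A\<close> at \<open>U\<close> that is determined by the vertex \<open>U\<close> and its
  neighbours. It agrees with \<open>rho\<close> at all the other vertices, see \<open>rho_affine_vertex\<close>.\<close>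

definition rho_affine ::
  "'p poc \<Rightarrow> ('p \<Rightarrow> real) \<Rightarrow> 'p set \<Rightarrow> 'p set \<Rightarrow> 'p set \<Rightarrow> ('p \<Rightarrow> real) \<Rightarrow> 'p \<Rightarrow> real" where
  "rho_affine P w B U A t =
     (\<lambda>p. rho w B U p + (\<Sum>a\<in>A. t a * (rho w B (flip P U {a}) p - rho w B U p)))"

definition face :: "'p poc \<Rightarrow> ('p \<Rightarrow> real) \<Rightarrow> 'p set \<Rightarrow> 'p set \<Rightarrow> 'p set \<Rightarrow> ('p \<Rightarrow> real) set" where
  "face P w B U A = rho_affine P w B U A ` {t. \<forall>a\<in>A. 0 \<le> t a \<and> t a \<le> 1}"

definition faces :: "'p poc \<Rightarrow> ('p \<Rightarrow> real) \<Rightarrow> 'p set \<Rightarrow> ('p \<Rightarrow> real) set set" where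
  "faces P w B = {face P w B U A | U A. U \<in> component P B \<and> spans_cube P U A}"

definition cubing :: "'p poc \<Rightarrow> ('p \<Rightarrow> real) \<Rightarrow> 'p set \<Rightarrow> ('p \<Rightarrow> real) set" where
  "cubing P w B = \<Union>(faces P w B)"

definition sup_dist :: "'p set \<Rightarrow> ('p \<Rightarrow> real) \<Rightarrow> ('p \<Rightarrow> real) \<Rightarrow> real" where
  "sup_dist B x y = (SUP p\<in>B. \<bar>x p - y p\<bar>)"

definition face_chain :: "'p poc \<Rightarrow> ('p \<Rightarrow> real) \<Rightarrow> 'p set \<Rightarrow>
    ('p \<Rightarrow> real) \<Rightarrow> ('p \<Rightarrow> real) \<Rightarrow> nat \<Rightarrow> (nat \<Rightarrow> 'p \<Rightarrow> real) \<Rightarrow> bool" where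
  "face_chain P w B x y m z \<longleftrightarrow>
     z 0 = x \<and> z m = y \<and> (\<forall>i<m. \<exists>F\<in>faces P w B. z i \<in> F \<and> z (Suc i) \<in> F)"

text \<open>The value \<open>0\<close> off the cubing is a convention required by \<open>Metric_space\<close>, whose
  distance function has to be nonnegative and symmetric on the whole type.\<close>

definition cubing_dist ::
  "'p poc \<Rightarrow> ('p \<Rightarrow> real) \<Rightarrow> 'p set \<Rightarrow> ('p \<Rightarrow> real) \<Rightarrow> ('p \<Rightarrow> real) \<Rightarrow> real" where
  "cubing_dist P w B x y =
     (if x \<in> cubing P w B \<and> y \<in> cubing P w B
      then Inf {\<Sum>i<m. sup_dist B (z (Suc i)) (z i) | m z. face_chain P w B x y m z}
      else 0)"

definition cubing_data :: "'p poc \<Rightarrow> ('p \<Rightarrow> real) \<Rightarrow> 'p set \<Rightarrow> bool" where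
  "cubing_data P w B \<longleftrightarrow>
     discrete_poc_set P \<and> nondegenerate_weight P w \<and> B \<in> ultrafilters P"

definition locally_finite_cubing :: "'p poc \<Rightarrow> 'p set \<Rightarrow> bool" where
  "locally_finite_cubing P B \<longleftrightarrow> (\<forall>U\<in>component P B. finite {C \<in> cubes P. U \<in> C})"


section \<open>Consistency of the definitions\<close>

lemma star_in: "poc_set P \<Longrightarrow> a \<in> elems P \<Longrightarrow> star P a \<in> elems P"
  by (auto simp: poc_set_def)

lemma star_star: "poc_set P \<Longrightarrow> a \<in> elems P \<Longrightarrow> star P (star P a) = a"
  by (auto simp: poc_set_def)

lemma ultrafilter_star:
  "U \<in> ultrafilters P \<Longrightarrow> a \<in> elems P \<Longrightarrow> star P a \<in> U \<longleftrightarrow> a \<notin> U"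
  unfolding ultrafilters_def by blast

lemma in_flip_iff:
  assumes P: "poc_set P" and U: "U \<in> ultrafilters P" and A: "A \<subseteq> U" and p: "p \<in> elems P"
  shows "p \<in> flip P U A \<longleftrightarrow> (if p \<in> U then p \<notin> A else star P p \<in> A)"
proof -
  have AE: "A \<subseteq> elems P" using A U by (auto simp: ultrafilters_def)
  have im: "p \<in> star P ` A \<longleftrightarrow> star P p \<in> A"
  proof
    assume "p \<in> star P ` A"
    then obtain a where a: "a \<in> A" "p = star P a" by blast
    then show "star P p \<in> A" using star_star[OF P, of a] AE by auto
  next
    assume "star P p \<in> A"
    then show "p \<in> star P ` A" using star_star[OF P p] by (metis imageI)
  qed
  have "star P p \<in> A \<Longrightarrow> p \<notin> U"
    using ultrafilter_star[OF U p] A by blast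
  then show ?thesis unfolding flip_def Un_iff Diff_iff im using A by (simp split: if_split) blast
qed

lemma rho_affine_vertex:
  assumes P: "poc_set P" and B: "B \<in> ultrafilters P" and s: "spans_cube P U A" and A': "A' \<subseteq> A"
  shows "rho_affine P w B U A (indicator A') = rho w B (flip P U A')"
proof
  fix p
  have U: "U \<in> ultrafilters P" and fA: "finite A" and AU: "A \<subseteq> U"
    using s by (auto simp: spans_cube_def)
  show "rho_affine P w B U A (indicator A') p = rho w B (flip P U A') p"
  proof (cases "p \<in> B")
    case False
    then show ?thesis by (simp add: rho_affine_def rho_def)
  next
    case pB: True
    then have pE: "p \<in> elems P" using B by (auto simp: ultrafilters_def)
    let ?q = "if p \<in> U then p else star P p"
    have *: "p \<in> flip P U D \<longleftrightarrow> (if p \<in> U then p \<notin> D else star P p \<in> D)" if "D \<subseteq> A" for D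
      using in_flip_iff[OF P U _ pE, of D] that AU by blast
    have 1: "(\<Sum>a\<in>A. indicator A' a * (rho w B (flip P U {a}) p - rho w B U p))
        = (\<Sum>a\<in>A. if a = ?q then indicator A' a * (if p \<in> U then w p else - w p) else 0)"
    proof (intro sum.cong refl)
      fix a assume "a \<in> A"
      then show "indicator A' a * (rho w B (flip P U {a}) p - rho w B U p) =
          (if a = ?q then indicator A' a * (if p \<in> U then w p else - w p) else 0)"
        using pB *[of "{a}"] by (cases "p \<in> U") (auto simp: rho_def indicator_def)
    qed
    also have "\<dots> = (if ?q \<in> A then indicator A' ?q * (if p \<in> U then w p else - w p) else 0)"
      using fA by (simp only: sum.delta)
    also have "\<dots> = (if ?q \<in> A' then (if p \<in> U then w p else - w p) else 0)"
      using A' by (cases "?q \<in> A'") (simp_all add: subset_iff)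
    finally have 2: "rho_affine P w B U A (indicator A') p =
        rho w B U p + (if ?q \<in> A' then (if p \<in> U then w p else - w p) else 0)"
      unfolding rho_affine_def by simp
    show ?thesis
      unfolding 2 using *[OF A'] pB by (cases "p \<in> U") (simp_all add: rho_def indicator_def)
  qed
qed

lemma flip_in_face:
  assumes "poc_set P" "B \<in> ultrafilters P" "spans_cube P U A" "A' \<subseteq> A"
  shows "rho w B (flip P U A') \<in> face P w B U A"
  unfolding face_def
  by (rule image_eqI[where x = "indicator A'"])
     (use rho_affine_vertex[OF assms] in \<open>auto simp: indicator_def\<close>)

lemma component_subset_ultrafilters:
  assumes "B \<in> ultrafilters P" "U \<in> component P B"
  shows "U \<in> ultrafilters P"
proof -
  have "(B, U) \<in> {(V, W). \<exists>C\<in>cubes P. V \<in> C \<and> W \<in> C}\<^sup>*"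
    using assms by (simp add: component_def)
  then show ?thesis
    by (induction) (use assms(1) in \<open>auto simp: cubes_def spans_cube_def\<close>)
qed

lemma component_step:
  assumes "V \<in> component P B" "C \<in> cubes P" "V \<in> C" "W \<in> C"
  shows "W \<in> component P B"
proof -
  have "(V, W) \<in> {(V, W). \<exists>C\<in>cubes P. V \<in> C \<and> W \<in> C}" using assms by blast
  moreover have "(B, V) \<in> {(V, W). \<exists>C\<in>cubes P. V \<in> C \<and> W \<in> C}\<^sup>*"
    using assms(1) by (simp add: component_def)
  ultimately have "(B, W) \<in> {(V, W). \<exists>C\<in>cubes P. V \<in> C \<and> W \<in> C}\<^sup>*"
    by (rule rtrancl_into_rtrancl[rotated])
  then show ?thesis by (simp add: component_def)
qed

lemma flip_in_component:
  assumes "U \<in> component P B" "spans_cube P U A" "A' \<subseteq> A"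
  shows "flip P U A' \<in> component P B"
proof -
  have "flip P U ` Pow A \<in> cubes P" using assms by (auto simp: cubes_def)
  moreover have "U = flip P U {}" by (simp add: flip_def)
  then have "U \<in> flip P U ` Pow A" by blast
  moreover have "flip P U A' \<in> flip P U ` Pow A" using assms by blast
  ultimately show ?thesis using assms(1) component_step by blast
qed

lemma component_eq:
  assumes P: "poc_set P" and B: "B \<in> ultrafilters P"
  shows "component P B = {U \<in> ultrafilters P. finite (U - B)}"
proof (intro equalityI subsetI)
  fix U assume U: "U \<in> component P B"
  then have "(B, U) \<in> {(V, W). \<exists>C\<in>cubes P. V \<in> C \<and> W \<in> C}\<^sup>*"
    by (simp add: component_def)
  then have "finite (U - B)"
  proof induction
    case (step V W)
    then obtain U' A where s: "spans_cube P U' A" "V \<in> flip P U' ` Pow A" "W \<in> flip P U' ` Pow A"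
      by (auto simp: cubes_def)
    then have "W - B \<subseteq> (V - B) \<union> A \<union> star P ` A" "finite A"
      by (auto simp: flip_def spans_cube_def)
    then show ?case using step.IH by (meson finite_Un finite_imageI finite_subset)
  qed simp
  then show "U \<in> {U \<in> ultrafilters P. finite (U - B)}"
    using component_subset_ultrafilters[OF B U] by simp
next
  fix U assume "U \<in> {U \<in> ultrafilters P. finite (U - B)}"
  then have "U \<in> ultrafilters P" "finite (U - B)" by auto
  then show "U \<in> component P B"
  proof (induction "card (U - B)" arbitrary: U rule: less_induct)
    case less
    have UE: "U \<subseteq> elems P" and BE: "B \<subseteq> elems P"
      using less.prems B by (auto simp: ultrafilters_def)
    have trans: "trans (le_rel P)" and anti: "antisym (le_rel P)"
      and refl: "refl_on (elems P) (le_rel P)" and leE: "le_rel P \<subseteq> elems P \<times> elems P"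
    proof -
      have "partial_order_on (elems P) (le_rel P)" using P unfolding poc_set_def by blast
      then show "trans (le_rel P)" "antisym (le_rel P)" "refl_on (elems P) (le_rel P)"
        "le_rel P \<subseteq> elems P \<times> elems P"
        by (rule partial_order_onD)+
    qed
    show ?case
    proof (cases "U - B = {}")
      case True
      then have "U = B"
      proof -
        have "U \<subseteq> B" using True by blast
        moreover have "x \<in> U" if "x \<in> B" for x
        proof (rule ccontr)
          assume "x \<notin> U"
          then have "star P x \<in> U" using ultrafilter_star[OF less.prems(1)] that BE by blast
          then show False using \<open>U \<subseteq> B\<close> ultrafilter_star[OF B, of x] that BE by blast
        qed
        ultimately show ?thesis by blast
      qed
      then show ?thesis by (simp add: component_def)
    next
      case False
      have "\<exists>a\<in>U - B. \<forall>b\<in>U - B. (b, a) \<in> le_rel P \<longrightarrow> b = a"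
      proof -
        let ?r = "{(x, y). (x, y) \<in> le_rel P \<and> x \<noteq> y}"
        have tr: "trans ?r" using trans anti by (auto simp: trans_def antisym_def)
        have "acyclic ?r" using tr by (auto simp: acyclic_def)
        then have ac: "acyclic (?r \<inter> (U - B) \<times> (U - B))"
          by (rule acyclic_subset) auto
        have "finite (?r \<inter> (U - B) \<times> (U - B))" using less.prems by auto
        then have "wf (?r \<inter> (U - B) \<times> (U - B))" using ac by (rule finite_acyclic_wf)
        then obtain a where "a \<in> U - B" "\<And>b. (b, a) \<in> ?r \<inter> (U - B) \<times> (U - B) \<Longrightarrow> b \<notin> U - B"
          using False by (meson ex_in_conv wfE_min)
        then show ?thesis by blast
      qed
      then obtain a where a: "a \<in> U" "a \<notin> B" and min: "\<And>b. b \<in> U \<Longrightarrow> b \<notin> B \<Longrightarrow> (b, a) \<in> le_rel P \<Longrightarrow> b = a"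
        by blast
      have aE: "a \<in> elems P" and saE: "star P a \<in> elems P" using a UE star_in[OF P] by auto
      have saB: "star P a \<in> B" using ultrafilter_star[OF B aE] a by simp
      have saU: "star P a \<notin> U" using ultrafilter_star[OF less.prems(1) aE] a by simp
      have ultraU: "\<And>x y. x \<in> U \<Longrightarrow> y \<in> U \<Longrightarrow> (x, star P y) \<notin> le_rel P"
        using less.prems(1) unfolding ultrafilters_def by blast
      have ultraB: "\<And>x y. x \<in> B \<Longrightarrow> y \<in> B \<Longrightarrow> (x, star P y) \<notin> le_rel P"
        using B unfolding ultrafilters_def by blast
      have star_le: "\<And>x y. (x, y) \<in> le_rel P \<Longrightarrow> (star P y, star P x) \<in> le_rel P"
        and zero: "zero_elem P \<in> elems P" "\<And>x. x \<in> elems P \<Longrightarrow> (zero_elem P, x) \<in> le_rel P"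
        and small: "\<And>x. x \<in> elems P \<Longrightarrow> (x, star P x) \<in> le_rel P \<Longrightarrow> x = zero_elem P"
        using P unfolding poc_set_def by blast+
      have a0: "a \<noteq> zero_elem P" using ultraU[OF a(1) a(1)] zero(2)[OF saE] by metis
      have a1: "a \<noteq> star P (zero_elem P)"
      proof
        assume e: "a = star P (zero_elem P)"
        then have "star P a = zero_elem P" using star_star[OF P zero(1)] by simp
        then show False using ultraB[OF saB saB] zero(2)[OF aE] star_star[OF P aE] by simp
      qed
      let ?V = "flip P U {a}"
      have V: "?V = insert (star P a) (U - {a})" by (auto simp: flip_def)
      have Vu: "?V \<in> ultrafilters P"
      proof -
        have 1: "?V \<subseteq> elems P" using V UE saE by auto
        have 2: "(x \<in> ?V) \<noteq> (star P x \<in> ?V)" if "x \<in> elems P" for x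
        proof -
          have n: "star P a \<noteq> a" using a saU by metis
          have e: "star P x = star P a \<longleftrightarrow> x = a" "star P x = a \<longleftrightarrow> x = star P a"
            using star_star[OF P that] star_star[OF P aE] by metis+
          show ?thesis
            unfolding V insert_iff Diff_iff empty_iff e
            using ultrafilter_star[OF less.prems(1) that] n saU a by metis
        qed
        have key: "(x, a) \<notin> le_rel P" if "x \<in> U - {a}" for x
        proof
          assume l: "(x, a) \<in> le_rel P"
          then have "x \<in> B" using min that by blast
          then show False using ultraB[OF _ saB] star_star[OF P aE] l by metis
        qed
        have 3: "(x, star P y) \<notin> le_rel P" if xy: "x \<in> ?V" "y \<in> ?V" for x y
        proof
          assume l: "(x, star P y) \<in> le_rel P"
          consider "x = star P a" "y = star P a" | "x = star P a" "y \<in> U - {a}"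
            | "x \<in> U - {a}" "y = star P a" | "x \<in> U" "y \<in> U"
            using xy unfolding V by blast
          then show False
          proof cases
            case 1 then show False using ultraB[OF saB saB] l by simp
          next
            case 2
            then have "(star P (star P y), star P (star P a)) \<in> le_rel P" using star_le l by blast
            moreover have "y \<in> elems P" using 2 UE by blast
            ultimately have "(y, a) \<in> le_rel P" using 2 star_star[OF P] aE by metis
            then show False using key 2 by blast
          next
            case 3 then show False using key l star_star[OF P aE] by metis
          next
            case 4 then show False using ultraU l by blast
          qed
        qed
        show ?thesis using 1 2 3 unfolding ultrafilters_def by blast
      qed
      have VB: "?V - B = (U - B) - {a}" using V saB by auto
      moreover have "card ((U - B) - {a}) < card (U - B)"
        using a less.prems(2) by (intro card_Diff1_less) auto
      ultimately have "card (?V - B) < card (U - B)" by simp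
      then have VC: "?V \<in> component P B" using less.hyps[of ?V] Vu VB less.prems(2) by auto
      have "spans_cube P U {a}"
        unfolding spans_cube_def
      proof (intro conjI allI impI)
        fix A' assume "A' \<subseteq> {a}"
        then have "A' = {} \<or> A' = {a}" by auto
        then show "flip P U A' \<in> ultrafilters P"
          using Vu less.prems(1) by (auto simp: flip_def)
      qed (use less.prems a a0 a1 aE in \<open>auto simp: proper_elems_def\<close>)
      then have "flip P U ` Pow {a} \<in> cubes P" by (auto simp: cubes_def)
      moreover have "U = flip P U {}" by (simp add: flip_def)
      then have "U \<in> flip P U ` Pow {a}" by blast
      moreover have "?V \<in> flip P U ` Pow {a}" by blast
      ultimately show ?thesis using VC component_step by blast
    qed
  qed
qed

lemma sup_dist_commute: "sup_dist B x y = sup_dist B y x"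
  by (simp add: sup_dist_def abs_minus_commute)

lemma face_coordinate:
  assumes "x \<in> face P w B U A" "poc_set P" "U \<in> ultrafilters P" "B \<in> ultrafilters P"
    "A \<subseteq> U" "p \<notin> A \<union> star P ` A"
  shows "x p = rho w B U p"
proof -
  have "rho w B (flip P U {a}) p = rho w B U p" if "a \<in> A" for a
  proof -
    have "p \<in> flip P U {a} \<longleftrightarrow> p \<in> U" using that assms(6) unfolding flip_def by blast
    then show ?thesis by (simp add: rho_def indicator_def)
  qed
  then show ?thesis using assms(1) by (auto simp: face_def rho_affine_def)
qed

lemma bdd_above_face:
  assumes P: "poc_set P" and B: "B \<in> ultrafilters P"
    and F: "F \<in> faces P w B" "x \<in> F" "y \<in> F"
  shows "bdd_above ((\<lambda>p. \<bar>x p - y p\<bar>) ` B)"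
proof -
  obtain U A where s: "spans_cube P U A" and F': "F = face P w B U A"
    using F by (auto simp: faces_def)
  then have U: "U \<in> ultrafilters P" "A \<subseteq> U" "finite A" by (auto simp: spans_cube_def)
  have "(\<lambda>p. \<bar>x p - y p\<bar>) ` B \<subseteq> insert 0 ((\<lambda>p. \<bar>x p - y p\<bar>) ` (A \<union> star P ` A))"
  proof
    fix r assume "r \<in> (\<lambda>p. \<bar>x p - y p\<bar>) ` B"
    then obtain p where r: "r = \<bar>x p - y p\<bar>" by blast
    have "x p = y p" if "p \<notin> A \<union> star P ` A"
      using face_coordinate[OF F(2)[unfolded F'] P U(1) B U(2) that]
        face_coordinate[OF F(3)[unfolded F'] P U(1) B U(2) that] by (rule trans[OF _ sym])
    then show "r \<in> insert 0 ((\<lambda>p. \<bar>x p - y p\<bar>) ` (A \<union> star P ` A))" using r by force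
  qed
  then show ?thesis
    using U(3) by (meson bdd_above_finite bdd_above_mono finite.insertI finite_UnI finite_imageI)
qed

lemma le_sup_dist:
  assumes "poc_set P" "B \<in> ultrafilters P" "F \<in> faces P w B" "x \<in> F" "y \<in> F" "p \<in> B"
  shows "\<bar>x p - y p\<bar> \<le> sup_dist B x y"
  unfolding sup_dist_def by (rule cSUP_upper[OF assms(6) bdd_above_face[OF assms(1-5)]])

lemma ultrafilter_nonempty:
  assumes "poc_set P" "B \<in> ultrafilters P"
  obtains p where "p \<in> B"
proof -
  have "zero_elem P \<in> elems P" using assms(1) unfolding poc_set_def by blast
  then have "star P (zero_elem P) \<in> B \<or> zero_elem P \<in> B"
    using ultrafilter_star[OF assms(2)] by blast
  then show ?thesis using that by blast
qed

lemma face_vanishes: "x \<in> F \<Longrightarrow> F \<in> faces P w B \<Longrightarrow> p \<notin> B \<Longrightarrow> x p = 0"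
  by (auto simp: faces_def face_def rho_affine_def rho_def)

lemma chain_coordinate:
  assumes P: "poc_set P" and B: "B \<in> ultrafilters P" and c: "face_chain P w B x y m z" and p: "p \<in> B"
  shows "\<bar>y p - x p\<bar> \<le> (\<Sum>i<m. sup_dist B (z (Suc i)) (z i))"
proof -
  have "y p - x p = (\<Sum>i<m. z (Suc i) p - z i p)"
    using c by (simp add: sum_lessThan_telescope[of "\<lambda>i. z i p"] face_chain_def)
  then have "\<bar>y p - x p\<bar> \<le> (\<Sum>i<m. \<bar>z (Suc i) p - z i p\<bar>)" by simp
  also have "\<dots> \<le> (\<Sum>i<m. sup_dist B (z (Suc i)) (z i))"
    using c le_sup_dist[OF P B _ _ _ p] by (intro sum_mono) (auto simp: face_chain_def)
  finally show ?thesis .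
qed

lemma chain_rev:
  assumes c: "face_chain P w B x y m z"
  shows "face_chain P w B y x m (\<lambda>i. z (m - i))"
    and "(\<Sum>i<m. sup_dist B (z (m - Suc i)) (z (m - i))) = (\<Sum>i<m. sup_dist B (z (Suc i)) (z i))"
proof -
  have "\<exists>F\<in>faces P w B. z (m - i) \<in> F \<and> z (m - Suc i) \<in> F" if "i < m" for i
  proof -
    have "m - Suc i < m" "Suc (m - Suc i) = m - i" using that by auto
    then show ?thesis using c unfolding face_chain_def by metis
  qed
  then show "face_chain P w B y x m (\<lambda>i. z (m - i))"
    using c by (auto simp: face_chain_def)
  have "(\<Sum>i<m. sup_dist B (z (Suc i)) (z i)) = (\<Sum>i<m. sup_dist B (z (Suc (m - Suc i))) (z (m - Suc i)))"
    by (rule sum.nat_diff_reindex[symmetric])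
  also have "\<dots> = (\<Sum>i<m. sup_dist B (z (m - Suc i)) (z (m - i)))"
    by (intro sum.cong) (auto simp: Suc_diff_Suc sup_dist_commute)
  finally show "(\<Sum>i<m. sup_dist B (z (m - Suc i)) (z (m - i))) = (\<Sum>i<m. sup_dist B (z (Suc i)) (z i))"
    by simp
qed

lemma chain_append:
  assumes c: "face_chain P w B x y m z" and c': "face_chain P w B y u k v"
  defines "q \<equiv> \<lambda>i. if i \<le> m then z i else v (i - m)"
  shows "face_chain P w B x u (m + k) q"
    and "(\<Sum>i<m + k. sup_dist B (q (Suc i)) (q i)) =
         (\<Sum>i<m. sup_dist B (z (Suc i)) (z i)) + (\<Sum>i<k. sup_dist B (v (Suc i)) (v i))"
proof -
  have e: "v 0 = z m" using c c' by (auto simp: face_chain_def)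
  have qv: "q (m + i) = v i" for i using e by (auto simp: q_def)
  have qz: "q i = z i" if "i \<le> m" for i using that by (simp add: q_def)
  have "\<exists>F\<in>faces P w B. q i \<in> F \<and> q (Suc i) \<in> F" if "i < m + k" for i
  proof (cases "i < m")
    case True
    then show ?thesis using c qz[of i] qz[of "Suc i"] by (auto simp: face_chain_def)
  next
    case False
    then have "i = m + (i - m)" "i - m < k" using that by auto
    then show ?thesis using c' qv[of "i - m"] qv[of "Suc (i - m)"] by (auto simp: face_chain_def)
  qed
  then show "face_chain P w B x u (m + k) q"
    using c c' qv[of k] qz[of 0] by (auto simp: face_chain_def)
  have "(\<Sum>i<m + k. sup_dist B (q (Suc i)) (q i)) =
    (\<Sum>i<m. sup_dist B (q (Suc i)) (q i)) + (\<Sum>i<k. sup_dist B (q (Suc (m + i))) (q (m + i)))"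
    by (induction k) auto
  also have "\<dots> = (\<Sum>i<m. sup_dist B (z (Suc i)) (z i)) + (\<Sum>i<k. sup_dist B (v (Suc i)) (v i))"
  proof -
    have "q (Suc (m + i)) = v (Suc i)" for i using qv[of "Suc i"] by simp
    then show ?thesis using qv qz by simp
  qed
  finally show "(\<Sum>i<m + k. sup_dist B (q (Suc i)) (q i)) =
         (\<Sum>i<m. sup_dist B (z (Suc i)) (z i)) + (\<Sum>i<k. sup_dist B (v (Suc i)) (v i))" .
qed

lemma chain_single:
  assumes "F \<in> faces P w B" "x \<in> F" "y \<in> F"
  shows "face_chain P w B x y 1 (\<lambda>i. if i = 0 then x else y)"
  using assms by (auto simp: face_chain_def)

lemma chain_base:
  assumes P: "poc_set P" and B: "B \<in> ultrafilters P" and x: "x \<in> cubing P w B"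
  shows "\<exists>m z. face_chain P w B (rho w B B) x m z"
proof -
  have vert: "\<exists>m z. face_chain P w B (rho w B B) (rho w B U) m z"
    if "(B, U) \<in> {(V, W). \<exists>C\<in>cubes P. V \<in> C \<and> W \<in> C}\<^sup>*" for U
    using that
  proof induction
    case base
    show ?case by (rule exI[of _ 0], rule exI[of _ "\<lambda>_. rho w B B"]) (simp add: face_chain_def)
  next
    case (step V W)
    obtain U' A D E where s: "spans_cube P U' A"
      and D: "D \<subseteq> A" "V = flip P U' D" and E: "E \<subseteq> A" "W = flip P U' E"
      using step.hyps(2) by (auto simp: cubes_def)
    have Vu: "V \<in> ultrafilters P" using s D by (auto simp: spans_cube_def)
    have U'E: "U' \<in> ultrafilters P" "A \<subseteq> U'" "finite A" using s by (auto simp: spans_cube_def)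
    have "V - B \<union> D \<supseteq> U' - B" using D by (auto simp: flip_def)
    moreover have "V \<in> component P B" using step.hyps(1) by (simp add: component_def)
    then have "finite (V - B)" using component_eq[OF P B] by blast
    moreover have "finite D" using D U'E finite_subset by blast
    ultimately have "finite (U' - B)" by (meson finite_UnI finite_subset)
    then have "U' \<in> component P B" using component_eq[OF P B] U'E by blast
    then have F: "face P w B U' A \<in> faces P w B" using s by (auto simp: faces_def)
    show ?case
      using step.IH chain_append(1) chain_single[OF F flip_in_face[OF P B s D(1)] flip_in_face[OF P B s E(1)]]
      unfolding D(2)[symmetric] E(2)[symmetric] by blast
  qed
  obtain U A where U: "U \<in> component P B" and s: "spans_cube P U A" and xF: "x \<in> face P w B U A"
    using x by (auto simp: cubing_def faces_def)
  have F: "face P w B U A \<in> faces P w B" using U s by (auto simp: faces_def)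
  have "rho w B U \<in> face P w B U A"
    using flip_in_face[OF P B s, of "{}" w] by (simp add: flip_def)
  then show ?thesis
    using vert[of U] U chain_append(1) chain_single[OF F _ xF] unfolding component_def by blast
qed

lemma chain_exists:
  assumes "poc_set P" "B \<in> ultrafilters P" "x \<in> cubing P w B" "y \<in> cubing P w B"
  shows "\<exists>m z. face_chain P w B x y m z"
proof -
  obtain m z where "face_chain P w B (rho w B B) x m z" using chain_base[OF assms(1-3)] by blast
  moreover obtain k v where "face_chain P w B (rho w B B) y k v"
    using chain_base[OF assms(1,2,4)] by blast
  ultimately show ?thesis using chain_append(1)[OF chain_rev(1)] by blast
qed

theorem Metric_space_cubing:
  assumes cd: "cubing_data P w B"
  shows "Metric_space (cubing P w B) (cubing_dist P w B)"
proof -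
  have P: "poc_set P" and B: "B \<in> ultrafilters P"
    using cd by (auto simp: cubing_data_def discrete_poc_set_def)
  let ?X = "cubing P w B" and ?d = "cubing_dist P w B"
  define L where "L x y = {\<Sum>i<m. sup_dist B (z (Suc i)) (z i) | m z. face_chain P w B x y m z}" for x y
  have LI: "(\<Sum>i<m. sup_dist B (z (Suc i)) (z i)) \<in> L x y" if "face_chain P w B x y m z" for x y m z
    using that unfolding L_def by blast
  have d: "?d x y = Inf (L x y)" if "x \<in> ?X" "y \<in> ?X" for x y
    using that by (simp add: cubing_dist_def L_def)
  have ne: "L x y \<noteq> {}" if "x \<in> ?X" "y \<in> ?X" for x y
    using chain_exists[OF P B that] by (auto simp: L_def)
  have coord: "\<bar>y p - x p\<bar> \<le> l" if "l \<in> L x y" "p \<in> B" for x y l p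
    using that chain_coordinate[OF P B] by (auto simp: L_def)
  obtain p0 where p0: "p0 \<in> B" using ultrafilter_nonempty[OF P B] .
  have nn: "0 \<le> l" if "l \<in> L x y" for x y l
    using coord[OF that p0] by linarith
  have bdd: "bdd_below (L x y)" for x y using nn by (meson bdd_belowI)
  have sub: "L x y \<subseteq> L y x" for x y
  proof
    fix l assume "l \<in> L x y"
    then obtain m z where c: "face_chain P w B x y m z" "l = (\<Sum>i<m. sup_dist B (z (Suc i)) (z i))"
      by (auto simp: L_def)
    then show "l \<in> L y x" using LI[OF chain_rev(1)[OF c(1)]] chain_rev(2)[OF c(1)] by simp
  qed
  show ?thesis
  proof
    fix x y
    show "0 \<le> ?d x y"
      using d ne nn by (cases "x \<in> ?X \<and> y \<in> ?X") (auto simp: cubing_dist_def intro!: cInf_greatest)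
    show "?d x y = ?d y x"
      using d[of x y] d[of y x] sub[of x y] sub[of y x]
      by (cases "x \<in> ?X \<and> y \<in> ?X") (auto simp: cubing_dist_def)
  next
    fix x y assume x: "x \<in> ?X" and y: "y \<in> ?X"
    show "?d x y = 0 \<longleftrightarrow> x = y"
    proof
      assume z: "?d x y = 0"
      show "x = y"
      proof
        fix p
        show "x p = y p"
        proof (cases "p \<in> B")
          case True
          have "\<bar>y p - x p\<bar> \<le> Inf (L x y)" using coord[OF _ True] ne[OF x y] by (intro cInf_greatest) auto
          then show ?thesis using z d[OF x y] by simp
        next
          case False
          then show ?thesis using x y face_vanishes unfolding cubing_def by (metis UnionE)
        qed
      qed
    next
      assume "x = y"
      moreover have "face_chain P w B x x 0 (\<lambda>_. x)" by (simp add: face_chain_def)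
      then have "0 \<in> L x x" using LI[of x x 0 "\<lambda>_. x"] by simp
      then have "Inf (L x x) = 0" using nn by (intro cInf_eq_minimum) auto
      ultimately show "?d x y = 0" using d x by simp
    qed
  next
    fix x y u assume x: "x \<in> ?X" and y: "y \<in> ?X" and u: "u \<in> ?X"
    have "Inf (L x u) \<le> l + l'" if l: "l \<in> L x y" "l' \<in> L y u" for l l'
    proof -
      obtain m z k v where c: "face_chain P w B x y m z" "l = (\<Sum>i<m. sup_dist B (z (Suc i)) (z i))"
        "face_chain P w B y u k v" "l' = (\<Sum>i<k. sup_dist B (v (Suc i)) (v i))"
        using l unfolding L_def by blast
      then have "l + l' \<in> L x u"
        using LI[OF chain_append(1)[OF c(1,3)]] chain_append(2)[OF c(1,3)] by simp
      then show ?thesis using bdd by (rule cInf_lower)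
    qed
    note sum_le = this
    have le: "Inf (L x u) - l \<le> l'" if "l \<in> L x y" "l' \<in> L y u" for l l'
      using sum_le[OF that] by linarith
    have le2: "Inf (L x u) - l \<le> Inf (L y u)" if "l \<in> L x y" for l
      using ne[OF y u] by (rule cInf_greatest) (rule le[OF that])
    have le': "Inf (L x u) - Inf (L y u) \<le> l" if "l \<in> L x y" for l
      using le2[OF that] by linarith
    have "Inf (L x u) - Inf (L y u) \<le> Inf (L x y)"
      using ne[OF x y] by (rule cInf_greatest) (rule le')
    then show "?d x u \<le> ?d x y + ?d y u" using d x y u by simp
  qed
qed

end

theory Submission
  imports Defs
begin

text \<open>
  A metric space is injective as soon as it is hyperconvex, that is, if every family of closed balls
  with \<open>d x y \<le> r + s\<close> for any two members has a common point. Two facts give hyperconvexity of the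
  limit.

  Every piecewise sup-norm cubing has this property for finite families, up to an arbitrarily small
  enlargement of the radii. Since the distance is defined by lengths of chains, two balls with
  \<open>d x y \<le> r + s\<close> almost meet (\<open>chain_split\<close>), so pairwise intersections come for free. To pass from
  pairs to finite families, a Helly argument is used. The cubing is closed under
  coordinatewise medians, and balls are convex: a ball that contains \<open>p\<close> and \<open>q\<close> contains the median
  of \<open>p\<close>, \<open>q\<close>, \<open>s\<close> for every point \<open>s\<close>. For three pairwise intersecting sets with this property the
  median of points in the three intersections lies in all of them, and induction does the rest
  (\<open>ternary_convex_Helly\<close>).

  Convexity of balls rests on a formula for the distance: \<open>d x y\<close> is the largest total increase from
  \<open>x\<close> to \<open>y\<close> along a nested family of halfspaces, i.e. a finite chain in the poc set. It is at least
  this number because inside one face at most one member of a chain of halfspaces can increase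
  (\<open>nested_bound_dst\<close>). It is at most this number by a greedy path (\<open>greedy_step\<close>): at unit speed raise
  all maximal halfspaces among those that still have to increase. These are pairwise transverse, so
  the path stays in a cube, and every optimal chain has one of them on top, so the total increase drops
  at unit speed. With the formula, convexity is immediate, because on a chain only the lowest member
  that increases can take a fractional value at the median: if one of \<open>p\<close> and \<open>q\<close> is at least as high
  as the median there, then it has the maximal value on all the others.

  The property passes to pointed Gromov--Hausdorff limits. The balls of the limit are totally bounded
  and complete, hence compact, and compactness upgrades approximate solutions for finite families
  to exact solutions for arbitrary families.
\<close>

section \<open>Hyperconvexity and injectivity\<close>

text \<open>A family of closed balls is encoded as the set of its pairs of centre and radius. The same pair
  may occur twice in the condition, which forces the radii to be nonnegative.\<close>

definition almost_hyperconvex :: "'x set \<Rightarrow> ('x \<Rightarrow> 'x \<Rightarrow> real) \<Rightarrow> bool" where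
  "almost_hyperconvex X d \<longleftrightarrow>
     (\<forall>F \<epsilon>. finite F \<longrightarrow> F \<noteq> {} \<longrightarrow> F \<subseteq> X \<times> UNIV \<longrightarrow> 0 < \<epsilon> \<longrightarrow>
        (\<forall>(x, r)\<in>F. \<forall>(y, s)\<in>F. d x y \<le> r + s) \<longrightarrow>
        (\<exists>z\<in>X. \<forall>(x, r)\<in>F. d x z \<le> r + \<epsilon>))"

definition hyperconvex :: "'x set \<Rightarrow> ('x \<Rightarrow> 'x \<Rightarrow> real) \<Rightarrow> bool" where
  "hyperconvex X d \<longleftrightarrow>
     (\<forall>F. F \<noteq> {} \<longrightarrow> F \<subseteq> X \<times> UNIV \<longrightarrow> (\<forall>(x, r)\<in>F. \<forall>(y, s)\<in>F. d x y \<le> r + s) \<longrightarrow>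
        (\<exists>z\<in>X. \<forall>(x, r)\<in>F. d x z \<le> r))"

text \<open>The theorem of Aronszajn and Panitchpakdi. By Zorn's lemma there is a maximal partial extension,
  here a relation between \<open>C\<close> and \<open>X\<close> that does not increase distances. Hyperconvexity provides
  a value at any further point \<open>u\<close>: the balls around the values at \<open>v\<close> with radii \<open>dC u v\<close> have a
  common point by the triangle inequality in \<open>C\<close>.\<close>

lemma hyperconvex_imp_injective:
  fixes X :: "'x set"
  assumes X: "Metric_space X d" and ne: "X \<noteq> {}" and hyp: "hyperconvex X d"
  shows "injective_metric_space TYPE('a) TYPE('c) X d"
  unfolding injective_metric_space_def
proof (intro conjI allI impI)
  fix A :: "'a set" and dA and C :: "'c set" and dC i f
  assume A: "Metric_space A dA" and C: "Metric_space C dC"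
    and i: "isometric_embedding_on A dA C dC i" and f: "nonexpansive_on A dA X d f"
  interpret X: Metric_space X d by (rule X)
  interpret C: Metric_space C dC by (rule C)
  define good where "good G \<longleftrightarrow> G \<subseteq> C \<times> X \<and> (\<forall>p\<in>G. \<forall>q\<in>G. d (snd p) (snd q) \<le> dC (fst p) (fst q))" for G
  define G0 where "G0 = (\<lambda>a. (i a, f a)) ` A"
  have G0: "good G0"
    using i f by (auto simp: good_def G0_def isometric_embedding_on_def nonexpansive_on_def)
  have "\<exists>M\<in>{G. good G \<and> G0 \<subseteq> G}. \<forall>G\<in>{G. good G \<and> G0 \<subseteq> G}. M \<subseteq> G \<longrightarrow> G = M"
  proof (rule subset_Zorn_nonempty)
    show "{G. good G \<and> G0 \<subseteq> G} \<noteq> {}" using G0 by blast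
    fix \<C> assume ne: "\<C> \<noteq> {}" and ch: "subset.chain {G. good G \<and> G0 \<subseteq> G} \<C>"
    have g: "good G \<and> G0 \<subseteq> G" if "G \<in> \<C>" for G using ch that by (auto simp: subset_chain_def)
    have "good (\<Union>\<C>)"
      unfolding good_def
    proof (intro conjI ballI)
      show "\<Union>\<C> \<subseteq> C \<times> X" using g unfolding good_def by blast
      fix p q assume "p \<in> \<Union>\<C>" "q \<in> \<Union>\<C>"
      then obtain G H where GH: "G \<in> \<C>" "p \<in> G" "H \<in> \<C>" "q \<in> H" by blast
      then have "G \<subseteq> H \<or> H \<subseteq> G" using ch by (auto simp: subset_chain_def)
      then obtain K where "K \<in> \<C>" "p \<in> K" "q \<in> K" using GH by blast
      then show "d (snd p) (snd q) \<le> dC (fst p) (fst q)"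
        using g[of K] unfolding good_def by blast
    qed
    then show "\<Union>\<C> \<in> {G. good G \<and> G0 \<subseteq> G}" using g ne by blast
  qed
  then obtain G where "G \<in> {G. good G \<and> G0 \<subseteq> G}"
    and max': "\<forall>H\<in>{G. good G \<and> G0 \<subseteq> G}. G \<subseteq> H \<longrightarrow> H = G" by (rule bexE)
  then have G: "good G" "G0 \<subseteq> G" by auto
  have max: "H = G" if "good H" "G \<subseteq> H" for H
    using max' that subset_trans[OF G(2) that(2)] by simp
  have GCX: "G \<subseteq> C \<times> X" and Gd: "\<And>u x v y. (u, x) \<in> G \<Longrightarrow> (v, y) \<in> G \<Longrightarrow> d x y \<le> dC u v"
    using G(1) unfolding good_def by (blast, force)
  have total: "\<exists>x. (u, x) \<in> G" if u: "u \<in> C" for u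
  proof -
    obtain z where z: "z \<in> X" "\<And>v x. (v, x) \<in> G \<Longrightarrow> d x z \<le> dC u v"
    proof (cases "G = {}")
      case True then show ?thesis using that ne by blast
    next
      case False
      define F where "F = (\<lambda>(v, x). (x, dC u v)) ` G"
      have "\<exists>z\<in>X. \<forall>(x, r)\<in>F. d x z \<le> r"
      proof (rule hyp[unfolded hyperconvex_def, rule_format])
        show "F \<noteq> {}" using False by (simp add: F_def)
        show "F \<subseteq> X \<times> UNIV" using GCX by (auto simp: F_def)
        have "d x y \<le> dC u v + dC u v'" if "(v, x) \<in> G" "(v', y) \<in> G" for v x v' y
        proof -
          have "v \<in> C" "v' \<in> C" using that GCX by auto
          then show ?thesis using Gd[OF that] C.triangle[of v u v'] C.commute[of v u] u by simp
        qed
        then show "case p of (x, r) \<Rightarrow> \<forall>(y, s)\<in>F. d x y \<le> r + s" if "p \<in> F" for p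
          using that by (auto simp: F_def)
      qed
      then show ?thesis using that unfolding F_def by fastforce
    qed
    have "good (insert (u, z) G)"
      using G(1) z u by (auto simp: good_def X.commute C.commute)
    then have "insert (u, z) G = G" by (rule max) blast
    then show ?thesis by blast
  qed
  define F where "F u = (SOME x. (u, x) \<in> G)" for u
  have F: "(u, F u) \<in> G" if "u \<in> C" for u
    unfolding F_def using total[OF that] by (rule someI_ex)
  have "nonexpansive_on C dC X d F"
    unfolding nonexpansive_on_def using F Gd GCX by blast
  moreover have "F (i a) = f a" if a: "a \<in> A" for a
  proof -
    have ia: "i a \<in> C" using i a by (auto simp: isometric_embedding_on_def)
    have mem: "(i a, f a) \<in> G" using G(2) a by (auto simp: G0_def)
    have "d (F (i a)) (f a) \<le> 0" using Gd[OF F[OF ia] mem] ia by simp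
    moreover have "F (i a) \<in> X" "f a \<in> X" using F[OF ia] mem GCX by auto
    ultimately show ?thesis using X.nonneg[of "F (i a)" "f a"] X.zero by (simp add: order_antisym)
  qed
  ultimately show "\<exists>F. nonexpansive_on C dC X d F \<and> (\<forall>a\<in>A. F (i a) = f a)" by blast
qed (rule X)

text \<open>All enlarged balls of the family are closed and, by assumption, have the finite intersection
  property inside one compact ball. A point in all of them lies in the balls that are not enlarged.\<close>

lemma (in Metric_space) almost_hyperconvex_imp_hyperconvex:
  assumes compact: "\<And>x r. compactin mtopology (mcball x r)" and alm: "almost_hyperconvex M d"
  shows "hyperconvex M d"
  unfolding hyperconvex_def
proof (intro allI impI)
  fix F assume ne: "F \<noteq> {}" and FM: "F \<subseteq> M \<times> UNIV"
    and close: "\<forall>(x, r)\<in>F. \<forall>(y, s)\<in>F. d x y \<le> r + s"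
  obtain x0 r0 where 0: "(x0, r0) \<in> F" using ne by auto
  define ball :: "('a \<times> real) \<times> real \<Rightarrow> 'a set" where "ball = (\<lambda>((x, r), e). mcball x (r + e))"
  let ?S = "mcball x0 (r0 + 1)" and ?U = "ball ` (F \<times> {0<..})"
  have "?S \<inter> \<Inter>?U \<noteq> {}"
  proof (rule compact[unfolded compactin_fip, THEN conjunct2, rule_format], intro conjI ballI allI impI)
    show "closedin mtopology C" if "C \<in> ?U" for C using that by (auto simp: ball_def)
    fix \<F> assume \<F>: "finite \<F> \<and> \<F> \<subseteq> ?U"
    then obtain K where K: "K \<subseteq> F \<times> {0<..}" "finite K" "\<F> = ball ` K"
      by (meson finite_subset_image)
    define \<epsilon> where "\<epsilon> = Min (insert 1 (snd ` K))"
    have pos: "0 < \<epsilon>" using K by (auto simp: \<epsilon>_def)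
    have \<epsilon>: "\<epsilon> \<le> e" if "e \<in> insert 1 (snd ` K)" for e
      unfolding \<epsilon>_def using K(2) that by (intro Min_le) auto
    let ?F = "insert (x0, r0) (fst ` K)"
    have sub: "?F \<subseteq> F" using 0 K by auto
    have close': "\<forall>(x, r)\<in>?F. \<forall>(y, s)\<in>?F. d x y \<le> r + s" using close sub by blast
    have fin: "finite ?F" and F': "?F \<noteq> {}" "?F \<subseteq> M \<times> UNIV" using K(2) sub FM by auto
    have "\<exists>z\<in>M. \<forall>(x, r)\<in>?F. d x z \<le> r + \<epsilon>"
      using alm fin F' pos close' unfolding almost_hyperconvex_def by blast
    then obtain z where z: "z \<in> M" "\<And>x r. (x, r) \<in> ?F \<Longrightarrow> d x z \<le> r + \<epsilon>" by blast
    have "z \<in> ?S" using z(2)[of x0 r0] \<epsilon>[of 1] 0 FM z(1) by auto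
    moreover have "z \<in> ball k" if k: "k \<in> K" for k
    proof -
      obtain x r e where k': "k = ((x, r), e)" by (metis prod.exhaust)
      have e: "\<epsilon> \<le> e" and mem: "(x, r) \<in> ?F" using k k' \<epsilon>[of e] by force+
      have "x \<in> M" using mem sub FM by blast
      moreover have "d x z \<le> r + e" using z(2)[OF mem] e by simp
      ultimately show ?thesis using z(1) by (simp add: ball_def k')
    qed
    ultimately show "?S \<inter> \<Inter>\<F> \<noteq> {}" using K(3) by blast
  qed
  then obtain z where z: "z \<in> ?S" "\<And>k. k \<in> F \<times> {0<..} \<Longrightarrow> z \<in> ball k" by blast
  have "d x z \<le> r" if "(x, r) \<in> F" for x r
  proof (rule field_le_epsilon)
    fix e :: real assume "0 < e"
    then show "d x z \<le> r + e" using z(2)[of "((x, r), e)"] that by (simp add: ball_def)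
  qed
  then show "\<exists>z\<in>M. \<forall>(x, r)\<in>F. d x z \<le> r" using z(1) by auto
qed

lemma dense_withinD:
  assumes "Metric_space X d" "dense_within \<epsilon> X d S" "x \<in> X"
  shows "\<exists>s\<in>S. d s x \<le> \<epsilon>"
proof -
  have "x \<in> (\<Union>s\<in>S. Metric_space.mcball X d s \<epsilon>)"
    using assms(2,3) unfolding dense_within_def by (rule subsetD)
  then show ?thesis using Metric_space.in_mcball[OF assms(1)] by auto
qed

lemma eps_approximationD:
  assumes R: "eps_approximation \<epsilon> X dX Y dY R" and X: "Metric_space X dX" and Y: "Metric_space Y dY"
  shows "x \<in> X \<Longrightarrow> \<exists>x' y'. (x', y') \<in> R \<and> dX x' x \<le> \<epsilon>"
    and "y \<in> Y \<Longrightarrow> \<exists>x' y'. (x', y') \<in> R \<and> dY y' y \<le> \<epsilon>"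
    and "(x1, y1) \<in> R \<Longrightarrow> (x2, y2) \<in> R \<Longrightarrow> \<bar>dX x1 x2 - dY y1 y2\<bar> < \<epsilon>"
    and "(x1, y1) \<in> R \<Longrightarrow> x1 \<in> X" and "(x1, y1) \<in> R \<Longrightarrow> y1 \<in> Y"
proof -
  have D: "R \<subseteq> X \<times> Y" "dense_within \<epsilon> X dX (fst ` R)" "dense_within \<epsilon> Y dY (snd ` R)"
    "\<forall>(x, y)\<in>R. \<forall>(x', y')\<in>R. \<bar>dX x x' - dY y y'\<bar> < \<epsilon>"
    using R unfolding eps_approximation_def by auto
  show "\<exists>x' y'. (x', y') \<in> R \<and> dX x' x \<le> \<epsilon>" if "x \<in> X"
    using dense_withinD[OF X D(2) that] by force
  show "\<exists>x' y'. (x', y') \<in> R \<and> dY y' y \<le> \<epsilon>" if "y \<in> Y"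
    using dense_withinD[OF Y D(3) that] by force
qed (use R in \<open>auto simp: eps_approximation_def\<close>)

section \<open>Pointed Gromov--Hausdorff limits\<close>

locale pointed_limit =
  fixes Y :: "nat \<Rightarrow> 'y set" and dY :: "nat \<Rightarrow> 'y \<Rightarrow> 'y \<Rightarrow> real" and b :: "nat \<Rightarrow> 'y"
    and X :: "'x set" and d :: "'x \<Rightarrow> 'x \<Rightarrow> real" and c :: 'x
  assumes Y: "\<And>n. Metric_space (Y n) (dY n)" and b: "\<And>n. b n \<in> Y n"
    and X: "Metric_space X d" and c: "c \<in> X"
    and conv: "pointed_GH_converges Y dY b X d c"
begin

sublocale X: Metric_space X d by (rule X)

abbreviation (input) ball_approx where
  "ball_approx \<epsilon> n r \<equiv>
     eps_approximation \<epsilon> (Metric_space.mcball (Y n) (dY n) (b n) r) (dY n) (X.mcball c r) d"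

lemma approximation:
  assumes "0 < r" "0 < \<epsilon>"
  obtains n R where "ball_approx \<epsilon> n r R"
proof -
  have "GH_converges (\<lambda>n. Metric_space.mcball (Y n) (dY n) (b n) r) dY (X.mcball c r) d"
    using conv assms(1) unfolding pointed_GH_converges_def by blast
  then show ?thesis using assms(2) that unfolding GH_converges_def by blast
qed

lemma approximationD:
  assumes R: "ball_approx \<epsilon> n r R"
  shows "x \<in> Y n \<Longrightarrow> dY n (b n) x \<le> r \<Longrightarrow> \<exists>x' y'. (x', y') \<in> R \<and> dY n x' x \<le> \<epsilon>"
    and "y \<in> X \<Longrightarrow> d c y \<le> r \<Longrightarrow> \<exists>x' y'. (x', y') \<in> R \<and> d y' y \<le> \<epsilon>"
    and "(x1, y1) \<in> R \<Longrightarrow> (x2, y2) \<in> R \<Longrightarrow> \<bar>dY n x1 x2 - d y1 y2\<bar> < \<epsilon>"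
    and "(x1, y1) \<in> R \<Longrightarrow> x1 \<in> Y n \<and> dY n (b n) x1 \<le> r"
    and "(x1, y1) \<in> R \<Longrightarrow> y1 \<in> X \<and> d c y1 \<le> r"
proof -
  interpret Y: Metric_space "Y n" "dY n" by (rule Y)
  have m: "Metric_space (Y.mcball (b n) r) (dY n)" "Metric_space (X.mcball c r) d"
    using Y.subspace[OF Y.mcball_subset_mspace] X.subspace[OF X.mcball_subset_mspace] by auto
  note D = eps_approximationD[OF R m]
  show "x \<in> Y n \<Longrightarrow> dY n (b n) x \<le> r \<Longrightarrow> \<exists>x' y'. (x', y') \<in> R \<and> dY n x' x \<le> \<epsilon>"
    using D(1)[of x] b by simp
  show "y \<in> X \<Longrightarrow> d c y \<le> r \<Longrightarrow> \<exists>x' y'. (x', y') \<in> R \<and> d y' y \<le> \<epsilon>"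
    using D(2)[of y] c by simp
  show "(x1, y1) \<in> R \<Longrightarrow> (x2, y2) \<in> R \<Longrightarrow> \<bar>dY n x1 x2 - d y1 y2\<bar> < \<epsilon>"
    by (rule D(3))
  show "(x1, y1) \<in> R \<Longrightarrow> x1 \<in> Y n \<and> dY n (b n) x1 \<le> r"
    using D(4)[of x1 y1] by simp
  show "(x1, y1) \<in> R \<Longrightarrow> y1 \<in> X \<and> d c y1 \<le> r"
    using D(5)[of x1 y1] by simp
qed

text \<open>A finite net of the approximated ball is moved to the limit: every point of the net that is close to
  the first component of a related pair is replaced by the second component of such a pair.\<close>

lemma limit_mtotally_bounded:
  assumes Yt: "\<And>n. Metric_space.mtotally_bounded (Y n) (dY n) (Metric_space.mcball (Y n) (dY n) (b n) r)"
    and r: "0 < r"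
  shows "X.mtotally_bounded (X.mcball c r)"
  unfolding X.mtotally_bounded_def
proof (intro allI impI)
  fix e :: real assume e: "0 < e"
  then have e4: "0 < e/4" by simp
  obtain n R where R: "ball_approx (e/4) n r R" by (rule approximation[OF r e4])
  note D = approximationD[OF R]
  interpret Y: Metric_space "Y n" "dY n" by (rule Y)
  obtain K where K: "finite K" "K \<subseteq> Y.mcball (b n) r" "Y.mcball (b n) r \<subseteq> (\<Union>k\<in>K. Y.mball k (e/4))"
    using Yt[of n, unfolded Y.mtotally_bounded_def, rule_format, OF e4] by (elim exE conjE)
  define near where "near k p \<longleftrightarrow> p \<in> R \<and> dY n k (fst p) < e/4" for k p
  define g where "g k = (SOME p. near k p)" for k
  have g: "near k (g k)" if "near k p" for k p unfolding g_def using that by (rule someI)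
  let ?K = "(\<lambda>k. snd (g k)) ` {k \<in> K. \<exists>p. near k p}"
  have gR: "(fst (g k), snd (g k)) \<in> R" "dY n k (fst (g k)) < e/4" if "near k p" for k p
    using g[OF that] by (auto simp: near_def)
  have "X.mcball c r \<subseteq> (\<Union>y\<in>?K. X.mball y e)"
  proof
    fix y assume "y \<in> X.mcball c r"
    then have y: "y \<in> X" "d c y \<le> r" by auto
    obtain x' y' where R': "(x', y') \<in> R" "d y' y \<le> e/4" using D(2)[OF y] by blast
    have x': "x' \<in> Y n" "dY n (b n) x' \<le> r" and y': "y' \<in> X" using D(4,5)[OF R'(1)] by auto
    then have "x' \<in> Y.mcball (b n) r" using b by simp
    then obtain k where k: "k \<in> K" "k \<in> Y n" "dY n k x' < e/4" using K(3) by force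
    then have near: "near k (x', y')" using R' by (simp add: near_def)
    let ?p = "fst (g k)" and ?q = "snd (g k)"
    have p: "?p \<in> Y n" and q: "?q \<in> X" using D(4,5)[OF gR(1)[OF near]] by auto
    have "dY n ?p x' < e/2"
      using Y.triangle[OF p k(2) x'(1)] gR(2)[OF near] k(3) by (simp add: Y.commute)
    moreover have "\<bar>dY n ?p x' - d ?q y'\<bar> < e/4" by (rule D(3)[OF gR(1)[OF near] R'(1)])
    ultimately have "d ?q y' < 3*e/4" by linarith
    then have "d ?q y < e" using X.triangle[OF q y' y(1)] R'(2) by linarith
    then have "y \<in> X.mball ?q e" using q y by simp
    then show "y \<in> (\<Union>y\<in>?K. X.mball y e)" using k(1) near by blast
  qed
  moreover have "?K \<subseteq> X.mcball c r" using D(5)[OF gR(1)] c by auto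
  moreover have "finite ?K" using K(1) by simp
  ultimately show "\<exists>K. finite K \<and> K \<subseteq> X.mcball c r \<and> X.mcball c r \<subseteq> (\<Union>x\<in>K. X.mball x e)"
    by blast
qed

text \<open>Approximations of balls need not match the base points, so the point found in \<open>Y n\<close> could lie
  outside of the ball that is approximated. The cure is to add a ball around \<open>b n\<close> to the family:
  all centres are within \<open>\<rho>\<close> of \<open>b n\<close>, hence with radius \<open>\<rho> - \<delta>\<close> it satisfies the distance
  condition against the enlarged radii, and the common point is within \<open>\<rho>\<close> of \<open>b n\<close>.\<close>

lemma limit_almost_hyperconvex:
  assumes alm: "\<And>n. almost_hyperconvex (Y n) (dY n)"
  shows "almost_hyperconvex X d"
  unfolding almost_hyperconvex_def
proof (intro allI impI)
  fix F and \<epsilon> :: real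
  assume F: "finite F" "F \<noteq> {}" "F \<subseteq> X \<times> UNIV" and \<epsilon>: "0 < \<epsilon>"
    and close: "\<forall>(x, r)\<in>F. \<forall>(y, s)\<in>F. d x y \<le> r + s"
  have mem: "fst i \<in> X" if "i \<in> F" for i using F that by auto
  have close': "d (fst i) (fst j) \<le> snd i + snd j" if "i \<in> F" "j \<in> F" for i j
    using close that by (force simp: case_prod_beta)
  have nn: "0 \<le> snd i" if "i \<in> F" for i
    using close'[OF that that] mem[OF that] by simp
  \<comment> \<open>The radii grow by \<open>2*\<delta>\<close> in the transfer to \<open>Y n\<close>, for the displaced centres and the distortion,
    and by \<open>\<delta>\<close> each for the common point, its related pair, the distortion on the way back and the
    return to the original centre.\<close>
  define \<delta> where "\<delta> = \<epsilon> / 6"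
  have \<delta>: "0 < \<delta>" using \<epsilon> by (simp add: \<delta>_def)
  define \<rho> where "\<rho> = \<delta> + (\<Sum>i\<in>F. d c (fst i))"
  have "0 \<le> (\<Sum>i\<in>F. d c (fst i))" by (intro sum_nonneg) auto
  then have \<rho>: "\<delta> \<le> \<rho>" "0 < \<rho>" using \<delta> by (auto simp: \<rho>_def)
  have in_ball: "d c (fst i) \<le> \<rho>" if "i \<in> F" for i
    using member_le_sum[OF that, of "\<lambda>i. d c (fst i)"] F(1) \<delta> by (simp add: \<rho>_def)
  obtain n R where R: "ball_approx \<delta> n \<rho> R" by (rule approximation[OF \<rho>(2) \<delta>])
  note D = approximationD[OF R]
  interpret Y: Metric_space "Y n" "dY n" by (rule Y)
  have "\<forall>i\<in>F. \<exists>p. p \<in> R \<and> d (snd p) (fst i) \<le> \<delta>" using D(2) mem in_ball by fastforce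
  then obtain f where f: "\<forall>i\<in>F. f i \<in> R \<and> d (snd (f i)) (fst i) \<le> \<delta>"
    using bchoice[of F "\<lambda>i p. p \<in> R \<and> d (snd p) (fst i) \<le> \<delta>"] by blast
  define u v where "u i = fst (f i)" and "v i = snd (f i)" for i
  have uv: "(u i, v i) \<in> R" "d (v i) (fst i) \<le> \<delta>" if "i \<in> F" for i
    using f that by (auto simp: u_def v_def)
  have uY: "u i \<in> Y n" "dY n (b n) (u i) \<le> \<rho>" and vX: "v i \<in> X" if "i \<in> F" for i
    using D(4,5)[OF uv(1)[OF that]] by auto
  have uu: "dY n (u i) (u j) \<le> (snd i + 2*\<delta>) + (snd j + 2*\<delta>)" if ij: "i \<in> F" "j \<in> F" for i j
  proof -
    have "d (v i) (v j) \<le> d (v i) (fst i) + d (fst i) (fst j) + d (fst j) (v j)"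
      using X.triangle[OF vX[OF ij(1)] mem[OF ij(1)] vX[OF ij(2)]]
        X.triangle[OF mem[OF ij(1)] mem[OF ij(2)] vX[OF ij(2)]] by linarith
    then have "d (v i) (v j) \<le> snd i + snd j + 2*\<delta>"
      using uv(2)[OF ij(1)] uv(2)[OF ij(2)] close'[OF ij] X.commute[of "fst j" "v j"] by linarith
    then show ?thesis using D(3)[OF uv(1)[OF ij(1)] uv(1)[OF ij(2)]] by linarith
  qed
  let ?F = "insert (b n, \<rho> - \<delta>) ((\<lambda>i. (u i, snd i + 2*\<delta>)) ` F)"
  have "\<exists>z\<in>Y n. \<forall>(x, r)\<in>?F. dY n x z \<le> r + \<delta>"
  proof (rule alm[unfolded almost_hyperconvex_def, rule_format])
    show "finite ?F" "?F \<noteq> {}" "0 < \<delta>" using F(1) \<delta> by auto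
    show "?F \<subseteq> Y n \<times> UNIV" using b uY by auto
    have "dY n (b n) (u i) \<le> (\<rho> - \<delta>) + (snd i + 2*\<delta>)" if "i \<in> F" for i
      using uY(2)[OF that] nn[OF that] \<delta> by linarith
    moreover have "dY n (b n) (b n) \<le> (\<rho> - \<delta>) + (\<rho> - \<delta>)" using \<rho> b by simp
    ultimately show "case p of (x, r) \<Rightarrow> \<forall>(y, s)\<in>?F. dY n x y \<le> r + s" if "p \<in> ?F" for p
      using that uu by (auto simp: Y.commute add.commute)
  qed
  then obtain z where z: "z \<in> Y n" "dY n (b n) z \<le> \<rho>" "\<And>i. i \<in> F \<Longrightarrow> dY n (u i) z \<le> snd i + 3*\<delta>"
    by force
  obtain p q where pq: "(p, q) \<in> R" "dY n p z \<le> \<delta>" using D(1)[OF z(1,2)] by blast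
  have p: "p \<in> Y n" and q: "q \<in> X" using D(4,5)[OF pq(1)] by auto
  have "d (fst i) q \<le> snd i + \<epsilon>" if i: "i \<in> F" for i
  proof -
    have "dY n (u i) p \<le> snd i + 4*\<delta>"
      using Y.triangle[OF uY(1)[OF i] z(1) p] z(3)[OF i] pq(2) by (simp add: Y.commute)
    then have "d (v i) q \<le> snd i + 5*\<delta>" using D(3)[OF uv(1)[OF i] pq(1)] by linarith
    then have "d (fst i) q \<le> snd i + 6*\<delta>"
      using X.triangle[OF mem[OF i] vX[OF i] q] uv(2)[OF i] X.commute[of "fst i" "v i"] by linarith
    then show ?thesis by (simp add: \<delta>_def)
  qed
  then show "\<exists>z\<in>X. \<forall>(x, r)\<in>F. d x z \<le> r + \<epsilon>" using q by force
qed

lemma limit_compact_balls: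
  assumes complete: "X.mcomplete" and proper: "\<And>n. proper_metric_space (Y n) (dY n)"
  shows "compactin X.mtopology (X.mcball x r)"
proof (cases "x \<in> X")
  case False
  then have "X.mcball x r = {}" by auto
  then show ?thesis by simp
next
  case x: True
  define s where "s = d c x + \<bar>r\<bar> + 1"
  have s: "0 < s" using X.nonneg[of c x] abs_ge_zero[of r] unfolding s_def by linarith
  have "Metric_space.mtotally_bounded (Y n) (dY n) (Metric_space.mcball (Y n) (dY n) (b n) s)" for n
  proof -
    interpret Y: Metric_space "Y n" "dY n" by (rule Y)
    have "compactin Y.mtopology (Y.mcball (b n) s)"
      using proper[of n] Y.closedin_mcball Y.mbounded_mcball unfolding proper_metric_space_def by blast
    then show ?thesis by (rule Y.compactin_imp_mtotally_bounded)
  qed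
  then have "X.mtotally_bounded (X.mcball c s)" using limit_mtotally_bounded s by blast
  then have "compactin X.mtopology (X.mtopology closure_of X.mcball c s)"
    using X.mtotally_bounded_eq_compact_closure_of[OF complete] by blast
  then have "compactin X.mtopology (X.mcball c s)" by (simp add: closure_of_closedin)
  moreover have "X.mcball x r \<subseteq> X.mcball c s"
    using c by (intro X.mcball_subset) (auto simp: s_def X.commute)
  ultimately show ?thesis using closed_compactin X.closedin_mcball by blast
qed

end

section \<open>Coordinates on a cubing\<close>

locale weighted_cubing =
  fixes P :: "'p poc" and w :: "'p \<Rightarrow> real" and B :: "'p set"
  assumes data: "cubing_data P w B"
begin

lemma poc: "poc_set P" and base: "B \<in> ultrafilters P"
  using data by (auto simp: cubing_data_def discrete_poc_set_def)

abbreviation elts :: "'p set" where "elts \<equiv> elems P"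

abbreviation le :: "'p \<Rightarrow> 'p \<Rightarrow> bool" (infix "\<preceq>" 50) where "a \<preceq> b \<equiv> (a, b) \<in> le_rel P"

abbreviation compl :: "'p \<Rightarrow> 'p" where "compl \<equiv> star P"

abbreviation pts :: "('p \<Rightarrow> real) set" where "pts \<equiv> cubing P w B"

abbreviation dst :: "('p \<Rightarrow> real) \<Rightarrow> ('p \<Rightarrow> real) \<Rightarrow> real" where "dst \<equiv> cubing_dist P w B"

lemma B_elts: "a \<in> B \<Longrightarrow> a \<in> elts"
  using base by (auto simp: ultrafilters_def)

lemma compl_elts: "a \<in> elts \<Longrightarrow> compl a \<in> elts"
  using star_in[OF poc] .

lemma compl_compl: "a \<in> elts \<Longrightarrow> compl (compl a) = a"
  using star_star[OF poc] .

lemma compl_B: "a \<in> elts \<Longrightarrow> compl a \<in> B \<longleftrightarrow> a \<notin> B"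
  using ultrafilter_star[OF base] .

lemma prec_elts: "a \<preceq> b \<Longrightarrow> a \<in> elts" "a \<preceq> b \<Longrightarrow> b \<in> elts"
  and prec_trans: "a \<preceq> b \<Longrightarrow> b \<preceq> c \<Longrightarrow> a \<preceq> c"
  and prec_antisym: "a \<preceq> b \<Longrightarrow> b \<preceq> a \<Longrightarrow> a = b"
  and prec_refl: "a \<in> elts \<Longrightarrow> a \<preceq> a"
proof -
  have po: "partial_order_on elts (le_rel P)" using poc unfolding poc_set_def by blast
  show "a \<preceq> b \<Longrightarrow> a \<in> elts" "a \<preceq> b \<Longrightarrow> b \<in> elts"
    using partial_order_onD(4)[OF po] by auto
  show "a \<preceq> b \<Longrightarrow> b \<preceq> c \<Longrightarrow> a \<preceq> c"
    using partial_order_onD(2)[OF po] by (meson transD)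
  show "a \<preceq> b \<Longrightarrow> b \<preceq> a \<Longrightarrow> a = b"
    using partial_order_onD(3)[OF po] by (meson antisymD)
  show "a \<in> elts \<Longrightarrow> a \<preceq> a"
    using partial_order_onD(1)[OF po] by (meson refl_onD)
qed

lemma compl_le: "a \<preceq> b \<Longrightarrow> compl b \<preceq> compl a"
  using poc unfolding poc_set_def by blast

lemma zero_prec: "a \<in> elts \<Longrightarrow> zero_elem P \<preceq> a"
  and zero_elts: "zero_elem P \<in> elts"
  using poc unfolding poc_set_def by blast+

lemma w_nonneg: "a \<in> elts \<Longrightarrow> 0 \<le> w a"
  and w_compl: "a \<in> elts \<Longrightarrow> w (compl a) = w a"
  and w_zero: "w (zero_elem P) = 0"
  and w_pos: "a \<in> proper_elems P \<Longrightarrow> 0 < w a"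
  using data by (auto simp: cubing_data_def nondegenerate_weight_def)

text \<open>Every element \<open>a\<close> of the poc set is a halfspace of the cubing, and \<open>val x a\<close> measures how far \<open>x\<close>
  has moved into it: the value is \<open>w a\<close> at the vertices \<open>U\<close> with \<open>a \<in> U\<close> and \<open>0\<close> at the others. The
  coordinates of \<open>x\<close> only record the halfspaces of the base vertex, and they count the distance from it.\<close>

definition val :: "('p \<Rightarrow> real) \<Rightarrow> 'p \<Rightarrow> real" where
  "val x a = (if a \<in> B then w a - x a else x (compl a))"

lemma val_compl: "a \<in> elts \<Longrightarrow> val x (compl a) = w a - val x a"
  by (simp add: val_def compl_B compl_compl w_compl)

lemma val_eqI:
  assumes "\<And>a. a \<notin> B \<Longrightarrow> x a = 0" "\<And>a. a \<notin> B \<Longrightarrow> y a = 0" "\<And>a. a \<in> elts \<Longrightarrow> val x a = val y a"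
  shows "x = y"
proof
  fix a show "x a = y a"
    using assms(1,2)[of a] assms(3)[of a] by (cases "a \<in> B") (auto simp: val_def B_elts)
qed

text \<open>The intrinsic description of the cubing, see \<open>pts_iff\<close>. The last condition is the continuous version
  of consistency for ultrafilters: a point that has begun to enter \<open>a\<close> has entered every larger \<open>b\<close>
  completely.\<close>

definition admissible :: "('p \<Rightarrow> real) \<Rightarrow> bool" where
  "admissible x \<longleftrightarrow>
     (\<forall>a. a \<notin> B \<longrightarrow> x a = 0) \<and> finite {a. x a \<noteq> 0} \<and>
     (\<forall>a\<in>elts. 0 \<le> val x a \<and> val x a \<le> w a) \<and>
     (\<forall>a b. a \<preceq> b \<longrightarrow> a \<noteq> b \<longrightarrow> val x a = 0 \<or> val x b = w b)"

lemma admissibleD: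
  assumes "admissible x"
  shows "a \<notin> B \<Longrightarrow> x a = 0" "finite {a. x a \<noteq> 0}"
    "a \<in> elts \<Longrightarrow> 0 \<le> val x a" "a \<in> elts \<Longrightarrow> val x a \<le> w a"
    "a \<preceq> b \<Longrightarrow> a \<noteq> b \<Longrightarrow> 0 < val x a \<Longrightarrow> val x b = w b"
    "a \<preceq> b \<Longrightarrow> a \<noteq> b \<Longrightarrow> val x b < w b \<Longrightarrow> val x a = 0"
  using assms unfolding admissible_def by force+

text \<open>The vertices of the cube that carries \<open>x\<close> arise by rounding: if a halfspace with positive value is
  chosen from every complementary pair, then the choice is consistent.\<close>

lemma selection_ultrafilter:
  assumes x: "admissible x"
    and U: "U \<subseteq> elts" "\<And>a. a \<in> elts \<Longrightarrow> (a \<in> U) \<noteq> (compl a \<in> U)" "zero_elem P \<notin> U"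
    and pos: "\<And>a. a \<in> U \<Longrightarrow> a \<in> proper_elems P \<Longrightarrow> 0 < val x a"
  shows "U \<in> ultrafilters P"
proof -
  have "\<not> a \<preceq> compl b" if ab: "a \<in> U" "b \<in> U" for a b
  proof
    assume le: "a \<preceq> compl b"
    have aE: "a \<in> elts" and bE: "b \<in> elts" using ab U by auto
    have ne: "a \<noteq> compl b" using U(2)[OF bE] ab by auto
    have a0: "a \<noteq> zero_elem P" and b0: "b \<noteq> zero_elem P" using ab U by auto
    have one: "c = zero_elem P" if "compl (zero_elem P) \<preceq> compl c" "c \<in> elts" for c
      using compl_le[OF that(1)] that(2) zero_elts compl_compl prec_antisym zero_prec by metis
    show False
    proof (cases "a \<in> proper_elems P \<and> b \<in> proper_elems P")
      case True
      then have "0 < val x a" "0 < val x b" using pos ab by auto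
      then have "val x (compl b) = w (compl b)" using admissibleD(5)[OF x le ne] by simp
      then show False using \<open>0 < val x b\<close> val_compl[OF bE] w_compl[OF bE] by simp
    next
      case False
      then consider "a = compl (zero_elem P)" | "b = compl (zero_elem P)"
        using a0 b0 aE bE by (auto simp: proper_elems_def)
      then show False
      proof cases
        case 1 then show False using one le b0 bE by metis
      next
        case 2 then show False using le a0 compl_compl[OF zero_elts] zero_prec[OF aE] prec_antisym by metis
      qed
    qed
  qed
  then show ?thesis using U unfolding ultrafilters_def by blast
qed

lemma rho_affine_coordinate:
  assumes s: "spans_cube P U A" and p: "p \<in> B"
  shows "rho_affine P w B U A t p =
    (if p \<in> A then w p * t p else if compl p \<in> A then w p * (1 - t (compl p))
     else if p \<in> U then 0 else w p)"
proof -
  have U: "U \<in> ultrafilters P" and fA: "finite A" and AU: "A \<subseteq> U"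
    using s by (auto simp: spans_cube_def)
  have pE: "p \<in> elts" using B_elts[OF p] .
  let ?q = "if p \<in> U then p else compl p"
  have *: "p \<in> flip P U {a} \<longleftrightarrow> (if p \<in> U then p \<noteq> a else compl p = a)" if "a \<in> A" for a
    using in_flip_iff[OF poc U _ pE, of "{a}"] that AU by auto
  have "(\<Sum>a\<in>A. t a * (rho w B (flip P U {a}) p - rho w B U p))
      = (\<Sum>a\<in>A. if a = ?q then t a * (if p \<in> U then w p else - w p) else 0)"
  proof (intro sum.cong refl)
    fix a assume "a \<in> A"
    then show "t a * (rho w B (flip P U {a}) p - rho w B U p) =
        (if a = ?q then t a * (if p \<in> U then w p else - w p) else 0)"
      using p *[of a] by (cases "p \<in> U") (auto simp: rho_def indicator_def)
  qed
  also have "\<dots> = (if ?q \<in> A then t ?q * (if p \<in> U then w p else - w p) else 0)"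
    using fA by (simp only: sum.delta)
  finally have 2: "rho_affine P w B U A t p =
      rho w B U p + (if ?q \<in> A then t ?q * (if p \<in> U then w p else - w p) else 0)"
    unfolding rho_affine_def by simp
  have "p \<in> U \<Longrightarrow> compl p \<notin> A" "p \<notin> U \<Longrightarrow> p \<notin> A"
    using ultrafilter_star[OF U pE] AU by auto
  then show ?thesis
    unfolding 2 using p by (cases "p \<in> U") (auto simp: rho_def indicator_def algebra_simps)
qed

lemma val_rho_affine:
  assumes s: "spans_cube P U A" and a: "a \<in> elts"
  shows "val (rho_affine P w B U A t) a =
    (if a \<in> A then w a * (1 - t a) else if compl a \<in> A then w a * t (compl a)
     else if a \<in> U then w a else 0)"
proof -
  have U: "U \<in> ultrafilters P" and AU: "A \<subseteq> U" using s by (auto simp: spans_cube_def)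
  have n: "\<not> (a \<in> A \<and> compl a \<in> A)" using ultrafilter_star[OF U a] AU by auto
  show ?thesis
  proof (cases "a \<in> B")
    case True
    then show ?thesis using n by (auto simp: val_def rho_affine_coordinate[OF s] algebra_simps)
  next
    case False
    then have "compl a \<in> B" using compl_B a by simp
    then show ?thesis using n False a ultrafilter_star[OF U a]
      by (auto simp: val_def rho_affine_coordinate[OF s] algebra_simps w_compl compl_compl)
  qed
qed

text \<open>If \<open>a\<close> below \<open>b\<close> violated the consistency condition at a point of a cube, then some vertex of
  that cube would contain \<open>a\<close> but not \<open>b\<close>.\<close>

lemma face_admissible:
  assumes F: "F \<in> faces P w B" and x: "x \<in> F"
  shows "admissible x"
proof -
  obtain U A t where U: "U \<in> component P B" and s: "spans_cube P U A"
    and t: "\<And>a. a \<in> A \<Longrightarrow> 0 \<le> t a \<and> t a \<le> 1" and xt: "x = rho_affine P w B U A t"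
    using F x by (auto simp: faces_def face_def)
  have Uu: "U \<in> ultrafilters P" and fA: "finite A" and AU: "A \<subseteq> U"
    and flips: "\<And>D. D \<subseteq> A \<Longrightarrow> flip P U D \<in> ultrafilters P"
    using s by (auto simp: spans_cube_def)
  have AE: "A \<subseteq> elts" using AU Uu by (auto simp: ultrafilters_def)
  have off: "x a = 0" if "a \<notin> B" for a using face_vanishes[OF x F that] .
  have fin: "finite {a. x a \<noteq> 0}"
  proof (rule finite_subset)
    show "{a. x a \<noteq> 0} \<subseteq> A \<union> compl ` A \<union> compl ` (U - B)"
    proof
      fix a assume "a \<in> {a. x a \<noteq> 0}"
      then have a: "a \<in> B" "x a \<noteq> 0" using off by auto
      then have aE: "a \<in> elts" using B_elts by simp
      show "a \<in> A \<union> compl ` A \<union> compl ` (U - B)"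
      proof (cases "a \<in> A \<or> compl a \<in> A")
        case True
        moreover have "a \<in> compl ` A" if "compl a \<in> A"
          using imageI[OF that, of compl] compl_compl[OF aE] by simp
        ultimately show ?thesis by blast
      next
        case False
        then have "a \<notin> U" using a rho_affine_coordinate[OF s a(1)] xt by auto
        then have "compl a \<in> U - B" using ultrafilter_star[OF Uu aE] compl_B[OF aE] a by simp
        then have "a \<in> compl ` (U - B)"
          using imageI[of "compl a" "U - B" compl] compl_compl[OF aE] by simp
        then show ?thesis by blast
      qed
    qed
    show "finite (A \<union> compl ` A \<union> compl ` (U - B))"
      using fA U component_eq[OF poc base] by auto
  qed
  have range: "0 \<le> val x a \<and> val x a \<le> w a" if "a \<in> elts" for a
    using t w_nonneg[OF that] unfolding xt val_rho_affine[OF s that]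
    by (auto intro: mult_left_le)
  have "val x a = 0 \<or> val x b = w b" if le: "a \<preceq> b" and ne: "a \<noteq> b" for a b
  proof (rule ccontr)
    assume "\<not> ?thesis"
    then have va: "val x a \<noteq> 0" and vb: "val x b \<noteq> w b" by auto
    have aE: "a \<in> elts" and bE: "b \<in> elts" using prec_elts[OF le] .
    have cne: "compl a \<noteq> compl b" using ne compl_compl aE bE by metis
    \<comment> \<open>Flipping \<open>D\<close> leads to a vertex of the cube that contains \<open>a\<close> but not \<open>b\<close>.\<close>
    define D where "D = {c \<in> A. c = compl a \<or> c = b}"
    have D: "D \<subseteq> A" by (auto simp: D_def)
    have DU: "D \<subseteq> U" using D AU by blast
    note fl = in_flip_iff[OF poc Uu DU]
    have ab: "a \<noteq> compl a" "compl b \<noteq> b"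
      using ultrafilter_star[OF base aE] ultrafilter_star[OF base bE] by metis+
    have aD: "a \<notin> D" using ne ab(1) by (simp add: D_def)
    have bD: "compl b \<notin> D" using cne[symmetric] ab(2) by (simp add: D_def)
    have "a \<in> A \<or> compl a \<in> A \<or> a \<in> U"
      using va unfolding xt val_rho_affine[OF s aE] by (simp split: if_splits)
    then have "a \<in> U \<or> compl a \<in> A" using AU by blast
    then have "a \<in> flip P U D" unfolding fl[OF aE] using aD by (cases "a \<in> U") (simp_all add: D_def)
    moreover have "b \<in> A \<or> compl b \<in> A \<or> b \<notin> U"
      using vb unfolding xt val_rho_affine[OF s bE] by (simp split: if_splits)
    then have "b \<in> A \<or> b \<notin> U" using ultrafilter_star[OF Uu bE] AU by (auto dest: subsetD)
    then have "b \<notin> flip P U D" unfolding fl[OF bE] using bD by (cases "b \<in> U") (simp_all add: D_def)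
    then have "compl b \<in> flip P U D" using ultrafilter_star[OF flips[OF D] bE] by simp
    moreover have "a \<preceq> compl (compl b)" using le compl_compl[OF bE] by simp
    ultimately show False using flips[OF D] unfolding ultrafilters_def by blast
  qed
  note cond = this
  show ?thesis
    unfolding admissible_def using off fin range cond by (intro conjI allI impI ballI) simp_all
qed

text \<open>The face constructed here is the smallest one that contains \<open>x\<close>: its directions are the halfspaces
  with fractional value, and all other values are frozen. It contains every point with values in
  the allowed range that agrees with \<open>x\<close> at the halfspaces that are not fractional. Hence two points lie in a common face whenever
  their midpoint lies in the cubing.\<close>

lemma admissible_face:
  assumes x: "admissible x"
  obtains F where "F \<in> faces P w B" "x \<in> F"
    "\<And>y. \<lbrakk>\<And>a. a \<notin> B \<Longrightarrow> y a = 0; \<And>a. a \<in> elts \<Longrightarrow> 0 \<le> val y a \<and> val y a \<le> w a;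
       \<And>a. a \<in> elts \<Longrightarrow> val x a = 0 \<or> val x a = w a \<Longrightarrow> val y a = val x a\<rbrakk> \<Longrightarrow> y \<in> F"
proof -
  define Fr where "Fr = {a \<in> elts. 0 < val x a \<and> val x a < w a}"
  define A where "A = Fr \<inter> B"
  define U where "U = A \<union> {a \<in> elts. val x a = w a \<and> a \<noteq> zero_elem P \<and> 0 < w a} \<union> {compl (zero_elem P)}"
  have vz: "val x (zero_elem P) = 0" using admissibleD(3,4)[OF x zero_elts] w_zero by simp
  have z: "zero_elem P \<notin> Fr" "compl (zero_elem P) \<notin> Fr"
    using vz w_zero val_compl[OF zero_elts] w_compl[OF zero_elts] by (auto simp: Fr_def)
  have Frc: "compl a \<in> Fr \<longleftrightarrow> a \<in> Fr" if "a \<in> elts" for a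
    using val_compl[OF that] w_compl[OF that] compl_elts[OF that] that by (auto simp: Fr_def)
  have proper: "a \<in> proper_elems P" if "a \<in> Fr" for a
    using that z by (auto simp: proper_elems_def Fr_def)
  have zc: "zero_elem P \<noteq> compl (zero_elem P)"
    using ultrafilter_star[OF base zero_elts] by metis
  have Pw: "0 < w a" if "a \<in> elts" "a \<noteq> zero_elem P" "a \<noteq> compl (zero_elem P)" for a
    using that w_pos by (simp add: proper_elems_def)
  have UE: "U \<subseteq> elts" using compl_elts[OF zero_elts] by (auto simp: U_def A_def Fr_def)
  have U0: "zero_elem P \<notin> U" using zc z by (auto simp: U_def A_def)
  have Uiff: "a \<in> U \<longleftrightarrow> (if a \<in> Fr then a \<in> B else val x a = w a)" if "a \<in> proper_elems P" for a
  proof -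
    have "a \<in> elts" "a \<noteq> zero_elem P" "a \<noteq> compl (zero_elem P)" "0 < w a" using that Pw by (auto simp: proper_elems_def)
    then show ?thesis by (auto simp: U_def A_def Fr_def)
  qed
  have compl_proper: "compl a \<in> proper_elems P" if "a \<in> proper_elems P" for a
    using that compl_elts compl_compl zero_elts unfolding proper_elems_def by (metis DiffD1 DiffD2 DiffI insert_iff singletonD)
  have Usel: "(a \<in> U) \<noteq> (compl a \<in> U)" if aE: "a \<in> elts" for a
  proof (cases "a \<in> proper_elems P")
    case True
    then have "0 < w a" using w_pos by simp
    then show ?thesis
      using Uiff[OF True] Uiff[OF compl_proper[OF True]] Frc[OF aE] compl_B[OF aE] val_compl[OF aE, of x]
        w_compl[OF aE] admissibleD(3,4)[OF x aE] aE
      by (auto simp: Fr_def)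
  next
    case False
    then have "a = zero_elem P \<or> a = compl (zero_elem P)" using aE by (auto simp: proper_elems_def)
    moreover have "compl (zero_elem P) \<in> U" by (simp add: U_def)
    ultimately show ?thesis using U0 compl_compl[OF zero_elts] by auto
  qed
  have Upos: "0 < val x a" if "a \<in> U" "a \<in> proper_elems P" for a
    using that Uiff[OF that(2)] w_pos[OF that(2)] by (auto simp: Fr_def split: if_splits)
  have Uu: "U \<in> ultrafilters P"
    by (rule selection_ultrafilter[OF x UE Usel U0 Upos])
  have AU: "A \<subseteq> U" by (auto simp: U_def)
  have Asub: "A \<subseteq> Fr" by (auto simp: A_def)
  have AE: "A \<subseteq> elts" by (auto simp: A_def Fr_def)
  have flips: "flip P U D \<in> ultrafilters P" if D: "D \<subseteq> A" for D
  proof (rule selection_ultrafilter[OF x])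
    have iff: "a \<in> flip P U D \<longleftrightarrow> (if a \<in> U then a \<notin> D else compl a \<in> D)" if "a \<in> elts" for a
      using in_flip_iff[OF poc Uu _ that, of D] D AU by blast
    show "flip P U D \<subseteq> elts" using UE D AE compl_elts by (auto simp: flip_def)
    show "(a \<in> flip P U D) \<noteq> (compl a \<in> flip P U D)" if "a \<in> elts" for a
      using iff[OF that] iff[OF compl_elts[OF that]] Usel[OF that] compl_compl[OF that] by auto
    have "compl (zero_elem P) \<notin> D" using z D Asub by auto
    then show "zero_elem P \<notin> flip P U D" using iff[OF zero_elts] U0 by auto
    show "0 < val x a" if "a \<in> flip P U D" "a \<in> proper_elems P" for a
    proof -
      have aE: "a \<in> elts" using that by (simp add: proper_elems_def)
      show ?thesis
      proof (cases "a \<in> U")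
        case True then show ?thesis using Upos that by simp
      next
        case False
        then have "compl a \<in> Fr" using iff[OF aE] that D Asub by auto
        then show ?thesis using Frc[OF aE] by (simp add: Fr_def)
      qed
    qed
  qed
  have Afin: "finite A"
  proof (rule finite_subset)
    show "A \<subseteq> {a. x a \<noteq> 0}" by (auto simp: A_def Fr_def val_def)
    show "finite {a. x a \<noteq> 0}" using admissibleD(2)[OF x] .
  qed
  have s: "spans_cube P U A"
    using Uu Afin AU proper Asub flips unfolding spans_cube_def by blast
  have "finite (U - B)"
  proof (rule finite_subset)
    show "U - B \<subseteq> insert (compl (zero_elem P)) (compl ` {a. x a \<noteq> 0})"
    proof
      fix a assume a: "a \<in> U - B"
      then have aE: "a \<in> elts" using UE by auto
      show "a \<in> insert (compl (zero_elem P)) (compl ` {a. x a \<noteq> 0})"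
      proof (cases "a \<in> proper_elems P")
        case True
        then have "x (compl a) \<noteq> 0" using Upos[of a] a by (auto simp: val_def)
        then show ?thesis using compl_compl[OF aE]
            by (intro insertI2 image_eqI[where x = "compl a"]) auto
      next
        case False
        then show ?thesis using a aE U0 by (auto simp: proper_elems_def)
      qed
    qed
    show "finite (insert (compl (zero_elem P)) (compl ` {a. x a \<noteq> 0}))" using admissibleD(2)[OF x] by simp
  qed
  then have UC: "U \<in> component P B" using Uu component_eq[OF poc base] by blast
  have mem: "y \<in> face P w B U A" if off: "\<And>a. a \<notin> B \<Longrightarrow> y a = 0"
    and range: "\<And>a. a \<in> elts \<Longrightarrow> 0 \<le> val y a \<and> val y a \<le> w a"
    and agree: "\<And>a. a \<in> elts \<Longrightarrow> val x a = 0 \<or> val x a = w a \<Longrightarrow> val y a = val x a" for y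
  proof -
    define t where "t a = 1 - val y a / w a" for a
    have t: "0 \<le> t a \<and> t a \<le> 1" if "a \<in> A" for a
    proof -
      have "a \<in> elts" "0 < w a" using that w_pos[OF proper, of a] Asub AE by auto
      then show ?thesis using range[of a] by (simp add: t_def)
    qed
    have "y = rho_affine P w B U A t"
    proof (rule val_eqI[OF off])
      show "rho_affine P w B U A t a = 0" if "a \<notin> B" for a
        using that by (simp add: rho_affine_def rho_def)
      show "val y a = val (rho_affine P w B U A t) a" if aE: "a \<in> elts" for a
      proof (cases "a \<in> Fr")
        case True
        then have pos: "0 < w a" using w_pos[OF proper] by simp
        show ?thesis
        proof (cases "a \<in> B")
          case True
          then have "a \<in> A" using \<open>a \<in> Fr\<close> by (simp add: A_def)
          then show ?thesis using pos by (simp add: val_rho_affine[OF s aE] t_def)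
        next
          case False
          then have "compl a \<in> A" "a \<notin> A" using \<open>a \<in> Fr\<close> Frc[OF aE] compl_B[OF aE] by (auto simp: A_def)
          then show ?thesis using pos
            by (simp add: val_rho_affine[OF s aE] t_def val_compl[OF aE] w_compl[OF aE] field_simps)
        qed
      next
        case False
        then have nA: "a \<notin> A" "compl a \<notin> A" using Frc[OF aE] Asub by auto
        have vx: "val x a = 0 \<or> val x a = w a"
          using False aE admissibleD(3,4)[OF x aE] by (auto simp: Fr_def)
        show ?thesis
        proof (cases "a \<in> proper_elems P")
          case True
          then have "val x a = (if a \<in> U then w a else 0)"
            using vx Uiff[OF True] False w_pos[OF True] by auto
          then show ?thesis using nA agree[OF aE vx] by (simp add: val_rho_affine[OF s aE])
        next
          case False
          then have "w a = 0" using aE w_zero w_compl[OF zero_elts] by (auto simp: proper_elems_def)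
          then show ?thesis using nA range[OF aE] by (simp add: val_rho_affine[OF s aE])
        qed
      qed
    qed
    then show ?thesis unfolding face_def using t by blast
  qed
  show ?thesis
  proof (rule that)
    show "face P w B U A \<in> faces P w B" using UC s by (auto simp: faces_def)
    show "x \<in> face P w B U A" by (rule mem) (use admissibleD[OF x] in auto)
  qed (rule mem)
qed

lemma pts_iff: "x \<in> pts \<longleftrightarrow> admissible x"
proof
  show "x \<in> pts \<Longrightarrow> admissible x" using face_admissible by (auto simp: cubing_def)
  show "admissible x \<Longrightarrow> x \<in> pts" unfolding cubing_def by (erule admissible_face) (rule UnionI)
qed

end

section \<open>The distance as a maximum over nested families of halfspaces\<close>

lemma finite_total_greatest:
  assumes "finite S" "S \<noteq> {}" "\<forall>a\<in>S. \<forall>b\<in>S. R a b \<or> R b a"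
    and trans: "\<And>a b c. R a b \<Longrightarrow> R b c \<Longrightarrow> R a c"
  shows "\<exists>b\<in>S. \<forall>a\<in>S. R a b"
  using assms(1-3)
proof (induction S rule: finite_ne_induct)
  case (singleton x) then show ?case by auto
next
  case (insert x S)
  then obtain b where b: "b \<in> S" "\<forall>a\<in>S. R a b" by auto
  have "R x x" "R x b \<or> R b x" using insert.prems b(1) by auto
  then show ?case using b trans[of _ b x] by auto
qed

context weighted_cubing
begin

lemma sup_dist_le:
  assumes "\<And>p. p \<in> B \<Longrightarrow> \<bar>x p - y p\<bar> \<le> L"
  shows "sup_dist B x y \<le> L"
proof -
  obtain p where "p \<in> B" using ultrafilter_nonempty[OF poc base] .
  then show ?thesis unfolding sup_dist_def by (intro cSUP_least assms) auto
qed

lemma sup_dist_nonneg: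
  assumes "F \<in> faces P w B" "x \<in> F" "y \<in> F" shows "0 \<le> sup_dist B x y"
proof -
  obtain p where "p \<in> B" using ultrafilter_nonempty[OF poc base] .
  then show ?thesis using le_sup_dist[OF poc base assms] abs_ge_zero order_trans by blast
qed

lemma val_diff_le_sup_dist:
  assumes F: "F \<in> faces P w B" "x \<in> F" "y \<in> F" and a: "a \<in> elts"
  shows "\<bar>val y a - val x a\<bar> \<le> sup_dist B y x"
proof (cases "a \<in> B")
  case True
  then show ?thesis using le_sup_dist[OF poc base F(1,3,2) True] by (simp add: val_def abs_minus_commute)
next
  case False
  then have "compl a \<in> B" using compl_B[OF a] by simp
  then show ?thesis using le_sup_dist[OF poc base F(1,3,2)] False by (simp add: val_def)
qed

lemma sup_dist_le_val:
  assumes "\<And>a. a \<in> elts \<Longrightarrow> \<bar>val x a - val y a\<bar> \<le> L"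
  shows "sup_dist B x y \<le> L"
proof (rule sup_dist_le)
  fix p assume "p \<in> B"
  then show "\<bar>x p - y p\<bar> \<le> L" using assms[OF B_elts, of p] by (simp add: val_def abs_minus_commute)
qed

lemma dst_le_chain:
  assumes "x \<in> pts" "y \<in> pts" "face_chain P w B x y m z"
  shows "dst x y \<le> (\<Sum>i<m. sup_dist B (z (Suc i)) (z i))"
proof -
  let ?L = "{\<Sum>i<m. sup_dist B (z (Suc i)) (z i) | m z. face_chain P w B x y m z}"
  have "0 \<le> l" if "l \<in> ?L" for l
    using that by (auto intro!: sum_nonneg dest: sup_dist_nonneg simp: face_chain_def)
  then have "bdd_below ?L" by (meson bdd_belowI)
  then have "Inf ?L \<le> (\<Sum>i<m. sup_dist B (z (Suc i)) (z i))"
    by (rule cInf_lower[rotated]) (use assms(3) in blast)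
  then show ?thesis using assms by (simp add: cubing_dist_def)
qed

lemma dst_less_chain:
  assumes "x \<in> pts" "y \<in> pts" "dst x y < L"
  obtains m z where "face_chain P w B x y m z" "(\<Sum>i<m. sup_dist B (z (Suc i)) (z i)) < L"
proof -
  let ?L = "{\<Sum>i<m. sup_dist B (z (Suc i)) (z i) | m z. face_chain P w B x y m z}"
  have "?L \<noteq> {}" using chain_exists[OF poc base assms(1,2)] by blast
  moreover have "Inf ?L < L" using assms by (simp add: cubing_dist_def)
  ultimately obtain l where "l \<in> ?L" "l < L" by (rule cInf_lessD[elim_format]) blast
  then show ?thesis using that by blast
qed

lemma face_pts: "F \<in> faces P w B \<Longrightarrow> x \<in> F \<Longrightarrow> x \<in> pts"
  by (auto simp: cubing_def)

lemma dst_face_le: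
  assumes "F \<in> faces P w B" "x \<in> F" "y \<in> F"
  shows "dst x y \<le> sup_dist B x y"
  using dst_le_chain[OF _ _ chain_single[OF assms]] face_pts assms by (simp add: sup_dist_commute)

lemma face_segment:
  assumes F: "F \<in> faces P w B" "x \<in> F" "y \<in> F" and u: "0 \<le> u" "u \<le> 1"
  shows "(\<lambda>a. (1 - u) * x a + u * y a) \<in> F"
proof -
  obtain U A where F': "F = face P w B U A" using F(1) by (auto simp: faces_def)
  obtain s t where s: "\<And>a. a \<in> A \<Longrightarrow> 0 \<le> s a \<and> s a \<le> 1" "x = rho_affine P w B U A s"
    and t: "\<And>a. a \<in> A \<Longrightarrow> 0 \<le> t a \<and> t a \<le> 1" "y = rho_affine P w B U A t"
    using F(2,3) unfolding F' face_def by blast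
  define v where "v a = (1 - u) * s a + u * t a" for a
  have "0 \<le> v a \<and> v a \<le> 1" if "a \<in> A" for a
    using s(1)[OF that] t(1)[OF that] u convex_bound_le[of "s a" 1 "t a" "1 - u" u] by (simp add: v_def)
  moreover have "(\<lambda>a. (1 - u) * x a + u * y a) = rho_affine P w B U A v"
  proof
    fix p
    let ?g = "\<lambda>a. rho w B (flip P U {a}) p - rho w B U p"
    have "(\<Sum>a\<in>A. v a * ?g a) = (1 - u) * (\<Sum>a\<in>A. s a * ?g a) + u * (\<Sum>a\<in>A. t a * ?g a)"
      unfolding v_def by (simp add: sum_distrib_left sum.distrib[symmetric] algebra_simps)
    then show "(1 - u) * x p + u * y p = rho_affine P w B U A v p"
      unfolding s(2) t(2) rho_affine_def by (simp add: algebra_simps)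
  qed
  ultimately show ?thesis unfolding F' face_def by blast
qed

lemma val_segment: "val (\<lambda>a. (1 - u) * x a + u * y a) a = (1 - u) * val x a + u * val y a"
  by (simp add: val_def algebra_simps)

definition nested :: "'p set \<Rightarrow> bool" where
  "nested S \<longleftrightarrow> finite S \<and> S \<subseteq> elts \<and> (\<forall>a\<in>S. \<forall>b\<in>S. a \<preceq> b \<or> b \<preceq> a)"

lemma nested_subset: "nested S \<Longrightarrow> T \<subseteq> S \<Longrightarrow> nested T"
  unfolding nested_def by (meson finite_subset subset_iff)

lemma nested_greatest: "nested S \<Longrightarrow> S \<noteq> {} \<Longrightarrow> \<exists>b\<in>S. \<forall>a\<in>S. a \<preceq> b"
  unfolding nested_def using finite_total_greatest[of S "(\<preceq>)"] prec_trans by blast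

lemma nested_least: "nested S \<Longrightarrow> S \<noteq> {} \<Longrightarrow> \<exists>b\<in>S. \<forall>a\<in>S. b \<preceq> a"
  unfolding nested_def using finite_total_greatest[of S "\<lambda>a b. b \<preceq> a"] prec_trans by blast

definition gain :: "('p \<Rightarrow> real) \<Rightarrow> ('p \<Rightarrow> real) \<Rightarrow> 'p \<Rightarrow> real" where
  "gain x y a = max 0 (val y a - val x a)"

lemma gain_nonneg: "0 \<le> gain x y a" by (simp add: gain_def)

text \<open>The distance from \<open>x\<close> to \<open>y\<close> is the least such bound, by \<open>nested_bound_dst\<close> and
  \<open>dst_le_nested_bound\<close>. Working with bounds avoids having to show that the supremum exists.\<close>

definition nested_bound :: "('p \<Rightarrow> real) \<Rightarrow> ('p \<Rightarrow> real) \<Rightarrow> real \<Rightarrow> bool" where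
  "nested_bound x y L \<longleftrightarrow> (\<forall>S. nested S \<longrightarrow> (\<Sum>a\<in>S. gain x y a) \<le> L)"

lemma nested_bound_nonneg: "nested_bound x y L \<Longrightarrow> 0 \<le> L"
  unfolding nested_bound_def by (drule spec[of _ "{}"]) (simp add: nested_def)

lemma nested_bound_mono: "nested_bound x y L \<Longrightarrow> L \<le> L' \<Longrightarrow> nested_bound x y L'"
  unfolding nested_bound_def by force

text \<open>If two nested halfspaces increased between points of the same face, then at the midpoint the
  smaller one would have positive value and the larger one would not have its full value.\<close>

lemma nested_gain_face:
  assumes F: "F \<in> faces P w B" "x \<in> F" "y \<in> F" and S: "nested S"
  shows "(\<Sum>a\<in>S. gain x y a) \<le> sup_dist B y x"
proof -
  define z where "z a = (1 - 1/2) * x a + 1/2 * y a" for a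
  have zF: "z \<in> F" unfolding z_def by (rule face_segment[OF F]) auto
  have z: "admissible z" using face_admissible[OF F(1) zF] .
  have vz: "val z a = (val x a + val y a) / 2" for a
    unfolding z_def using val_segment[of "1/2" x y a] by simp
  have adm: "admissible x" "admissible y" using face_admissible F by blast+
  have ss: "finite S" "S \<subseteq> elts" using S by (auto simp: nested_def)
  have no2: False if "a \<preceq> b" "a \<noteq> b" "val x a < val y a" "val x b < val y b" for a b
  proof -
    have E: "a \<in> elts" "b \<in> elts" using prec_elts[OF that(1)] .
    have "0 < val z a" using vz[of a] that(3) admissibleD(3)[OF adm(1) E(1)] by simp
    then have "val z b = w b" using admissibleD(5)[OF z that(1,2)] by simp
    then show False using vz[of b] that(4) admissibleD(4)[OF adm(2) E(2)] by simp
  qed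
  show ?thesis
  proof (cases "\<exists>a\<in>S. val x a < val y a")
    case True
    then obtain a where a: "a \<in> S" "val x a < val y a" by blast
    have "gain x y b = 0" if "b \<in> S - {a}" for b
    proof -
      have "a \<preceq> b \<or> b \<preceq> a" using a that S by (auto simp: nested_def)
      then show ?thesis using no2[of a b] no2[of b a] a that by (force simp: gain_def)
    qed
    then have "(\<Sum>a\<in>S. gain x y a) = gain x y a"
      using a ss by (subst sum.remove[of _ a]) auto
    also have "\<dots> \<le> sup_dist B y x"
      using val_diff_le_sup_dist[OF F, of a] a ss by (auto simp: gain_def)
    finally show ?thesis .
  next
    case False
    then have "(\<Sum>a\<in>S. gain x y a) = 0" by (intro sum.neutral) (auto simp: gain_def)
    then show ?thesis using sup_dist_nonneg[OF F(1,3,2)] by simp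
  qed
qed

lemma nested_bound_dst:
  assumes x: "x \<in> pts" and y: "y \<in> pts"
  shows "nested_bound x y (dst x y)"
  unfolding nested_bound_def
proof (intro allI impI)
  fix S assume S: "nested S"
  have "(\<Sum>a\<in>S. gain x y a) \<le> (\<Sum>i<m. sup_dist B (z (Suc i)) (z i))"
    if c: "face_chain P w B x y m z" for m z
  proof -
    have "gain (z 0) (z k) a \<le> (\<Sum>i<k. gain (z i) (z (Suc i)) a)" for a k
      by (induction k) (auto simp: gain_def)
    then have "(\<Sum>a\<in>S. gain x y a) \<le> (\<Sum>a\<in>S. \<Sum>i<m. gain (z i) (z (Suc i)) a)"
      using c by (intro sum_mono) (auto simp: face_chain_def)
    also have "\<dots> = (\<Sum>i<m. \<Sum>a\<in>S. gain (z i) (z (Suc i)) a)" by (rule sum.swap)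
    also have "\<dots> \<le> (\<Sum>i<m. sup_dist B (z (Suc i)) (z i))"
      using c by (intro sum_mono) (auto simp: face_chain_def intro: nested_gain_face[OF _ _ _ S])
    finally show ?thesis .
  qed
  note le = this
  show "(\<Sum>a\<in>S. gain x y a) \<le> dst x y"
  proof (rule ccontr)
    assume "\<not> ?thesis"
    then have "dst x y < (\<Sum>a\<in>S. gain x y a)" by simp
    then obtain m z where "face_chain P w B x y m z"
      "(\<Sum>i<m. sup_dist B (z (Suc i)) (z i)) < (\<Sum>a\<in>S. gain x y a)"
      by (rule dst_less_chain[OF x y])
    then show False using le by force
  qed
qed

lemma finite_val_differ:
  assumes "admissible x" "admissible y"
  shows "finite {a \<in> elts. val x a \<noteq> val y a}"
proof (rule finite_subset)
  let ?T = "{a. x a \<noteq> 0} \<union> {a. y a \<noteq> 0}"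
  show "{a \<in> elts. val x a \<noteq> val y a} \<subseteq> ?T \<union> compl ` ?T"
  proof
    fix a assume "a \<in> {a \<in> elts. val x a \<noteq> val y a}"
    then have aE: "a \<in> elts" and ne: "val x a \<noteq> val y a" by auto
    show "a \<in> ?T \<union> compl ` ?T"
    proof (cases "a \<in> B")
      case True then show ?thesis using ne by (auto simp: val_def)
    next
      case False
      then have "compl a \<in> ?T" using ne by (auto simp: val_def)
      then have "compl (compl a) \<in> compl ` ?T" by (rule imageI)
      then show ?thesis using compl_compl[OF aE] by simp
    qed
  qed
  show "finite (?T \<union> compl ` ?T)" using admissibleD(2) assms by auto
qed

lemma Metric_space_pts: "Metric_space pts dst"
  using Metric_space_cubing[OF data] .

text \<open>From \<open>x\<close> move towards \<open>y\<close> by raising all maximal elements of the set \<open>D\<close> of halfspaces that must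
  increase, at unit speed, until the first of them (\<open>a0\<close>) has reached its final value. Maximality keeps
  the path admissible: whatever lies above a rising halfspace has its full value in \<open>y\<close> and, not
  being in \<open>D\<close>, already in \<open>x\<close>. Every chain in \<open>D\<close> can be extended by a rising halfspace on top, so the
  bound decreases by the time spent.\<close>

lemma greedy_step:
  assumes x: "admissible x" and y: "admissible y" and ne: "x \<noteq> y"
  obtains x' \<delta> where "0 < \<delta>" "admissible x'" "dst x x' \<le> \<delta>"
    "\<forall>L. nested_bound x y L \<longrightarrow> nested_bound x' y (L - \<delta>)"
    "{a \<in> elts. val x' a < val y a} \<subset> {a \<in> elts. val x a < val y a}"
proof -
  define D where "D = {a \<in> elts. val x a < val y a}"
  have Dfin: "finite D"
    by (rule finite_subset[OF _ finite_val_differ[OF x y]]) (auto simp: D_def)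
  have DE: "D \<subseteq> elts" by (auto simp: D_def)
  have "D \<noteq> {}"
  proof
    assume "D = {}"
    then have le: "val y a \<le> val x a" if "a \<in> elts" for a using that by (force simp: D_def)
    have "val x a = val y a" if "a \<in> elts" for a
      using le[OF that] le[OF compl_elts[OF that]] val_compl[OF that] by simp
    then show False using val_eqI[of x y] admissibleD(1) x y ne by blast
  qed
  define M where "M = {a \<in> D. \<forall>b\<in>D. a \<preceq> b \<longrightarrow> b = a}"
  have MD: "M \<subseteq> D" by (auto simp: M_def)
  have Mfin: "finite M" using Dfin MD finite_subset by blast
  have below: "\<exists>c\<in>M. b \<preceq> c" if b: "b \<in> D" for b
    using b
  proof (induction "card {c \<in> D. b \<preceq> c}" arbitrary: b rule: less_induct)
    case less
    show ?case
    proof (cases "b \<in> M")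
      case True then show ?thesis using prec_refl less.prems DE by blast
    next
      case False
      then obtain c where c: "c \<in> D" "b \<preceq> c" "c \<noteq> b" using less.prems by (auto simp: M_def)
      have "{d \<in> D. c \<preceq> d} \<subset> {d \<in> D. b \<preceq> d}"
        using c prec_trans prec_antisym prec_refl less.prems DE by blast
      then have "card {d \<in> D. c \<preceq> d} < card {d \<in> D. b \<preceq> d}" using Dfin by (intro psubset_card_mono) auto
      then obtain d where "d \<in> M" "c \<preceq> d" using less.hyps c by blast
      then show ?thesis using c prec_trans by blast
    qed
  qed
  have "M \<noteq> {}" using \<open>D \<noteq> {}\<close> below by blast
  define \<delta> where "\<delta> = Min ((\<lambda>a. val y a - val x a) ` M)"
  have \<delta>le: "val x a + \<delta> \<le> val y a" if "a \<in> M" for a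
  proof -
    have "\<delta> \<le> val y a - val x a" unfolding \<delta>_def using Mfin that by (intro Min_le) auto
    then show ?thesis by simp
  qed
  have "\<delta> \<in> (\<lambda>a. val y a - val x a) ` M" unfolding \<delta>_def using Mfin \<open>M \<noteq> {}\<close> by (intro Min_in) auto
  then obtain a0 where a0: "a0 \<in> M" "\<delta> = val y a0 - val x a0" by blast
  have \<delta>pos: "0 < \<delta>" using a0 MD by (auto simp: D_def)
  have Dc: "compl a \<notin> D" if "a \<in> D" for a
    using that val_compl[of a] by (auto simp: D_def)
  have \<delta>le': "val y a \<le> val x a - \<delta>" if "compl a \<in> M" "a \<in> elts" for a
    using \<delta>le[OF that(1)] val_compl[OF that(2)] by simp
  have Dc': "val y a < val x a \<longleftrightarrow> compl a \<in> D" if "a \<in> elts" for a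
    using that val_compl[OF that] compl_elts[OF that] by (auto simp: D_def)
  have Mc: "compl a \<notin> M" if "a \<in> M" for a using that MD Dc by blast
  define move where "move \<eta> p = (if p \<notin> B then 0 else if p \<in> M then x p - \<eta>
      else if compl p \<in> M then x p + \<eta> else x p)" for \<eta> p
  have vm: "val (move \<eta>) a = (if a \<in> M then val x a + \<eta> else if compl a \<in> M then val x a - \<eta> else val x a)"
    if "a \<in> elts" for a \<eta>
    using that Mc[of a] Mc[of "compl a"] compl_B[OF that] compl_compl[OF that] by (auto simp: val_def move_def)
  have adm: "admissible (move \<eta>)" if \<eta>: "0 \<le> \<eta>" "\<eta> \<le> \<delta>" for \<eta>
  proof -
    have up: "val x a \<le> val (move \<eta>) a \<and> val (move \<eta>) a \<le> val y a" if "a \<in> M" "a \<in> elts" for a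
      using vm[OF that(2)] that \<delta>le[OF that(1)] \<eta> by simp
    have down: "val (move \<eta>) a \<le> val x a \<and> val y a \<le> val (move \<eta>) a" if "compl a \<in> M" "a \<in> elts" for a
      using vm[OF that(2), of \<eta>] that \<delta>le'[OF that] \<eta> Mc[of a] by auto
    have stay: "val (move \<eta>) a = val x a" if "a \<notin> M" "compl a \<notin> M" "a \<in> elts" for a
      using vm[OF that(3), of \<eta>] that by simp
    have fin: "finite {a. move \<eta> a \<noteq> 0}"
    proof (rule finite_subset)
      show "{a. move \<eta> a \<noteq> 0} \<subseteq> {a. x a \<noteq> 0} \<union> M \<union> compl ` M"
      proof
        fix a assume a: "a \<in> {a. move \<eta> a \<noteq> 0}"
        then have aE: "a \<in> elts" using B_elts by (auto simp: move_def split: if_splits)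
        have "a \<in> compl ` M" if "compl a \<in> M" using imageI[OF that, of compl] compl_compl[OF aE] by simp
        then show "a \<in> {a. x a \<noteq> 0} \<union> M \<union> compl ` M" using a by (auto simp: move_def split: if_splits)
      qed
      show "finite ({a. x a \<noteq> 0} \<union> M \<union> compl ` M)" using Mfin admissibleD(2)[OF x] by auto
    qed
    have range: "0 \<le> val (move \<eta>) a \<and> val (move \<eta>) a \<le> w a" if "a \<in> elts" for a
      using up[of a] down[of a] stay[of a] that admissibleD(3,4)[OF x that] admissibleD(3,4)[OF y that]
      by (cases "a \<in> M"; cases "compl a \<in> M") linarith+
    have cond: "val (move \<eta>) a = 0 \<or> val (move \<eta>) b = w b" if ab: "a \<preceq> b" "a \<noteq> b" for a b
    proof (rule ccontr)
      assume "\<not> ?thesis"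
      then have pos: "0 < val (move \<eta>) a" and lt: "val (move \<eta>) b < w b"
        using range[OF prec_elts(1)[OF ab(1)]] range[OF prec_elts(2)[OF ab(1)]] by linarith+
      have aE: "a \<in> elts" and bE: "b \<in> elts" using prec_elts[OF ab(1)] .
      show False
      proof (cases "0 < val x a")
        case True
        then have vb: "val x b = w b" using admissibleD(5)[OF x ab] by simp
        have bM: "compl b \<in> M"
        proof (rule ccontr)
          assume n: "compl b \<notin> M"
          show False using up[of b] stay[of b] n vb lt bE by (cases "b \<in> M") linarith+
        qed
        then have "val y b < w b" using down[OF bM bE] lt by linarith
        then have "val y a = 0" using admissibleD(6)[OF y ab] by simp
        then have "compl a \<in> D" using Dc'[OF aE] True by simp
        moreover have "compl b \<preceq> compl a" using compl_le[OF ab(1)] .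
        ultimately have "compl a = compl b" using bM by (auto simp: M_def)
        then show False using ab(2) compl_compl[OF aE] compl_compl[OF bE] by metis
      next
        case False
        then have va: "val x a = 0" using admissibleD(3)[OF x aE] by linarith
        have aM: "a \<in> M"
        proof (rule ccontr)
          assume n: "a \<notin> M"
          show False using down[of a] stay[of a] n va pos aE by (cases "compl a \<in> M") linarith+
        qed
        then have "0 < val y a" using up[OF aM aE] pos by linarith
        then have vyb: "val y b = w b" using admissibleD(5)[OF y ab] by simp
        have "b \<notin> D" using aM ab by (auto simp: M_def)
        then have "val x b = w b" using vyb admissibleD(4)[OF x bE] bE by (auto simp: D_def)
        then show False
          using up[of b] down[of b] stay[of b] lt vyb bE by (cases "b \<in> M"; cases "compl b \<in> M") linarith+
      qed
    qed
    show ?thesis unfolding admissible_def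
      using fin range cond by (intro conjI allI impI ballI) (simp_all add: move_def)
  qed
  let ?x = "move \<delta>"
  have x': "admissible ?x" using adm[of \<delta>] \<delta>pos by simp
  obtain F where F: "F \<in> faces P w B" and
    mem: "\<And>z. \<lbrakk>\<And>a. a \<notin> B \<Longrightarrow> z a = 0; \<And>a. a \<in> elts \<Longrightarrow> 0 \<le> val z a \<and> val z a \<le> w a;
       \<And>a. a \<in> elts \<Longrightarrow> val (move (\<delta>/2)) a = 0 \<or> val (move (\<delta>/2)) a = w a \<Longrightarrow> val z a = val (move (\<delta>/2)) a\<rbrakk> \<Longrightarrow> z \<in> F"
    using admissible_face[OF adm[of "\<delta>/2"]] \<delta>pos by (smt (verit) field_sum_of_halves)
  \<comment> \<open>At the midpoint \<open>move (\<delta>/2)\<close> of the segment all moving halfspaces are fractional, so both ends lie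
    in the face \<open>F\<close> that carries the midpoint.\<close>
  have inner: "a \<notin> M \<and> compl a \<notin> M"
    if "a \<in> elts" "val (move (\<delta>/2)) a = 0 \<or> val (move (\<delta>/2)) a = w a" for a
  proof -
    have "0 < val (move (\<delta>/2)) a \<and> val (move (\<delta>/2)) a < w a" if aM: "a \<in> M \<or> compl a \<in> M"
      using \<open>a \<in> elts\<close> aM \<delta>le[of a] \<delta>le'[of a] \<delta>pos Mc[of a] admissibleD(3,4)[OF x \<open>a \<in> elts\<close>]
        admissibleD(3,4)[OF y \<open>a \<in> elts\<close>] vm[OF \<open>a \<in> elts\<close>, of "\<delta>/2"]
      by (smt (verit) field_sum_of_halves)
    then show ?thesis using that(2) by auto
  qed
  have xF: "x \<in> F"
  proof (rule mem)
    show "val x a = val (move (\<delta>/2)) a" if "a \<in> elts" "val (move (\<delta>/2)) a = 0 \<or> val (move (\<delta>/2)) a = w a" for a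
      using inner[OF that] vm[OF that(1)] by simp
  qed (use admissibleD[OF x] in auto)
  have x'F: "?x \<in> F"
  proof (rule mem)
    show "val ?x a = val (move (\<delta>/2)) a" if "a \<in> elts" "val (move (\<delta>/2)) a = 0 \<or> val (move (\<delta>/2)) a = w a" for a
      using inner[OF that] vm[OF that(1)] by simp
  qed (use admissibleD[OF x'] in auto)
  have "sup_dist B x ?x \<le> \<delta>"
    by (rule sup_dist_le_val) (use vm \<delta>pos in simp)
  then have d: "dst x ?x \<le> \<delta>" using dst_face_le[OF F xF x'F] by simp
  have nb: "nested_bound ?x y (L - \<delta>)" if L: "nested_bound x y L" for L
    unfolding nested_bound_def
  proof (intro allI impI)
    fix S assume S: "nested S"
    have g0: "gain ?x y a = 0" if "a \<in> S - D" for a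
    proof -
      have aE: "a \<in> elts" using that S by (auto simp: nested_def)
      have "val y a \<le> val x a" using that aE by (auto simp: D_def)
      moreover have "a \<notin> M" using that MD by blast
      ultimately show ?thesis using vm[OF aE, of \<delta>] \<delta>le'[OF _ aE] by (auto simp: gain_def)
    qed
    have gx: "gain ?x y a \<le> gain x y a" if "a \<in> D" for a
    proof -
      have aE: "a \<in> elts" using that DE by blast
      have "compl a \<notin> M" using Dc[OF that] MD by blast
      then show ?thesis using vm[OF aE, of \<delta>] \<delta>pos by (auto simp: gain_def)
    qed
    have gM: "gain ?x y a = gain x y a - \<delta>" if "a \<in> M" for a
    proof -
      have aE: "a \<in> elts" using that DE MD by blast
      show ?thesis using vm[OF aE, of \<delta>] \<delta>pos \<delta>le[OF that] that by (auto simp: gain_def)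
    qed
    have Sfin: "finite S" using S by (simp add: nested_def)
    have SD: "nested (S \<inter> D)" using nested_subset[OF S] by blast
    \<comment> \<open>Members of \<open>S\<close> outside of \<open>D\<close> gain nothing; the rest of \<open>S\<close> is extended by a rising \<open>c\<close>.\<close>
    obtain c where c: "c \<in> M" "nested (insert c (S \<inter> D))"
    proof (cases "S \<inter> D = {}")
      case True
      have "nested {a0}" using a0 MD DE prec_refl by (auto simp: nested_def)
      then show ?thesis using that[of a0] a0 True by simp
    next
      case False
      obtain b where b: "b \<in> S \<inter> D" "\<forall>a\<in>S \<inter> D. a \<preceq> b"
        using nested_greatest[OF SD False] by blast
      obtain c where c: "c \<in> M" "b \<preceq> c" using below[of b] b(1) by blast
      have "a \<preceq> c" if "a \<in> S \<inter> D" for a using b(2) that c(2) prec_trans by blast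
      moreover have "c \<preceq> c" using prec_elts(2)[OF c(2)] prec_refl by blast
      ultimately have "nested (insert c (S \<inter> D))" using SD prec_elts(2)[OF c(2)] unfolding nested_def by auto
      then show ?thesis using that c by blast
    qed
    let ?T = "insert c (S \<inter> D)"
    have Tfin: "finite ?T" using Sfin by simp
    have cD: "c \<in> D" using c MD by blast
    have "(\<Sum>a\<in>S. gain ?x y a) = (\<Sum>a\<in>S \<inter> D. gain ?x y a)"
      using g0 Sfin by (intro sum.mono_neutral_right) auto
    also have "\<dots> \<le> (\<Sum>a\<in>?T. gain ?x y a)"
      using Tfin by (intro sum_mono2) (auto simp: gain_nonneg)
    also have "\<dots> = gain ?x y c + (\<Sum>a\<in>?T - {c}. gain ?x y a)"
      using Tfin by (intro sum.remove) auto
    also have "\<dots> \<le> (gain x y c - \<delta>) + (\<Sum>a\<in>?T - {c}. gain x y a)"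
      using gM[OF c(1)] gx by (intro add_mono sum_mono) auto
    also have "\<dots> = (\<Sum>a\<in>?T. gain x y a) - \<delta>"
      using Tfin sum.remove[of ?T c "gain x y"] by simp
    also have "\<dots> \<le> L - \<delta>" using L c(2) unfolding nested_bound_def by simp
    finally show "(\<Sum>a\<in>S. gain ?x y a) \<le> L - \<delta>" .
  qed
  have "{a \<in> elts. val ?x a < val y a} \<subseteq> D"
  proof
    fix a assume "a \<in> {a \<in> elts. val ?x a < val y a}"
    then have a: "a \<in> elts" "val ?x a < val y a" by auto
    have "val x a < val y a"
      using a vm[OF a(1), of \<delta>] \<delta>le'[OF _ a(1)] \<delta>pos by (auto split: if_splits)
    then show "a \<in> D" using a by (simp add: D_def)
  qed
  moreover have "a0 \<in> D" using a0 MD by blast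
  moreover have "a0 \<notin> {a \<in> elts. val ?x a < val y a}" using a0 vm[of a0 \<delta>] by auto
  ultimately have sub: "{a \<in> elts. val ?x a < val y a} \<subset> D" by blast
  show ?thesis using that[OF \<delta>pos x' d] nb sub unfolding D_def by blast
qed

lemma dst_le_nested_bound:
  assumes "x \<in> pts" "y \<in> pts" "nested_bound x y L"
  shows "dst x y \<le> L"
  using assms
proof (induction "card {a \<in> elts. val x a < val y a}" arbitrary: x L rule: less_induct)
  case less
  interpret Metric_space pts dst by (rule Metric_space_pts)
  show ?case
  proof (cases "x = y")
    case True
    then show ?thesis
      using nested_bound_nonneg[OF less.prems(3)] mdist_zero[OF less.prems(1)] by simp
  next
    case False
    have adm: "admissible x" "admissible y" using less.prems pts_iff by auto
    obtain x' \<delta> where x': "admissible x'" "dst x x' \<le> \<delta>"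
      and nb: "\<forall>L. nested_bound x y L \<longrightarrow> nested_bound x' y (L - \<delta>)"
      and sub: "{a \<in> elts. val x' a < val y a} \<subset> {a \<in> elts. val x a < val y a}"
      by (rule greedy_step[OF adm False])
    have "finite {a \<in> elts. val x a < val y a}"
      by (rule finite_subset[OF _ finite_val_differ[OF adm]]) auto
    then have "card {a \<in> elts. val x' a < val y a} < card {a \<in> elts. val x a < val y a}"
      using sub by (rule psubset_card_mono)
    moreover have x'X: "x' \<in> pts" using x' pts_iff by simp
    ultimately have "dst x' y \<le> L - \<delta>"
      using less.hyps[OF _ x'X less.prems(2)] nb less.prems(3) by blast
    then show ?thesis using triangle[OF less.prems(1) x'X less.prems(2)] x'(2) by simp
  qed
qed

end

section \<open>Medians and convexity of balls\<close>

definition med :: "real \<Rightarrow> real \<Rightarrow> real \<Rightarrow> real" where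
  "med a b c = max (min a b) (max (min b c) (min a c))"

lemma med_majority: "med a a b = a" "med a b a = a" "med b a a = a"
  by (auto simp: med_def)

definition median_point :: "('p \<Rightarrow> real) \<Rightarrow> ('p \<Rightarrow> real) \<Rightarrow> ('p \<Rightarrow> real) \<Rightarrow> 'p \<Rightarrow> real" where
  "median_point x y z = (\<lambda>p. med (x p) (y p) (z p))"

lemma median_point_swap:
  "median_point x y z = median_point y x z" "median_point x y z = median_point x z y"
  by (simp_all add: median_point_def med_def fun_eq_iff ac_simps)

text \<open>If \<open>m\<close> is the median of a median algebra, these are its convex subsets. The Helly property only
  uses the symmetry of \<open>m\<close>.\<close>

definition ternary_convex :: "('a \<Rightarrow> 'a \<Rightarrow> 'a \<Rightarrow> 'a) \<Rightarrow> 'a set \<Rightarrow> 'a set \<Rightarrow> bool" where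
  "ternary_convex m X C \<longleftrightarrow> C \<subseteq> X \<and> (\<forall>p\<in>C. \<forall>q\<in>C. \<forall>s\<in>X. m p q s \<in> C)"

lemma ternary_convex_Helly:
  assumes sym: "\<And>x y z. m x y z = m y x z" "\<And>x y z. m x y z = m x z y"
    and "finite I" "I \<noteq> {}" "\<And>i. i \<in> I \<Longrightarrow> ternary_convex m X (C i)"
    and "\<And>i j. i \<in> I \<Longrightarrow> j \<in> I \<Longrightarrow> C i \<inter> C j \<noteq> {}"
  shows "(\<Inter>i\<in>I. C i) \<noteq> {}"
  using assms(3-)
proof (induction I arbitrary: C rule: finite_ne_induct)
  case (singleton i)
  then show ?case by simp
next
  case (insert i I)
  have "(\<Inter>j\<in>I. C j \<inter> C i) \<noteq> {}"
  proof (rule insert.IH)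
    show "ternary_convex m X (C j \<inter> C i)" if "j \<in> I" for j
      using insert.prems(1)[of j] insert.prems(1)[of i] that unfolding ternary_convex_def by blast
    fix j k assume jk: "j \<in> I" "k \<in> I"
    have c: "ternary_convex m X (C i)" "ternary_convex m X (C j)" "ternary_convex m X (C k)"
      using insert.prems(1) jk by auto
    obtain p where p: "p \<in> C j" "p \<in> C k" using insert.prems(2)[of j k] jk by blast
    obtain q where q: "q \<in> C j" "q \<in> C i" using insert.prems(2)[of j i] jk by blast
    obtain s where s: "s \<in> C k" "s \<in> C i" using insert.prems(2)[of k i] jk by blast
    have "p \<in> X" "q \<in> X" "s \<in> X" using c p q s unfolding ternary_convex_def by blast+
    then have "m p q s \<in> C j" "m p s q \<in> C k" "m q s p \<in> C i"
      using c p q s unfolding ternary_convex_def by blast+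
    moreover have "m p s q = m p q s" "m q s p = m p q s" using sym by metis+
    ultimately show "C j \<inter> C i \<inter> (C k \<inter> C i) \<noteq> {}" by auto
  qed
  then show ?case using insert.hyps by auto
qed

context weighted_cubing
begin

lemma val_median_point:
  assumes "a \<in> elts"
  shows "val (median_point x y z) a = med (val x a) (val y a) (val z a)"
  by (auto simp: val_def median_point_def med_def min_def max_def)

lemma admissible_median_point:
  assumes x: "admissible x" and y: "admissible y" and z: "admissible z"
  shows "admissible (median_point x y z)"
  unfolding admissible_def
proof (intro conjI allI impI ballI)
  let ?m = "median_point x y z"
  show "?m a = 0" if "a \<notin> B" for a
    using admissibleD(1)[OF x that] admissibleD(1)[OF y that] admissibleD(1)[OF z that]
    by (simp add: median_point_def med_def)
  show "finite {a. ?m a \<noteq> 0}"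
  proof (rule finite_subset)
    show "{a. ?m a \<noteq> 0} \<subseteq> {a. x a \<noteq> 0} \<union> {a. y a \<noteq> 0} \<union> {a. z a \<noteq> 0}"
      by (auto simp: median_point_def med_def)
    show "finite ({a. x a \<noteq> 0} \<union> {a. y a \<noteq> 0} \<union> {a. z a \<noteq> 0})"
      using admissibleD(2) x y z by auto
  qed
  show "0 \<le> val ?m a" "val ?m a \<le> w a" if "a \<in> elts" for a
    using admissibleD(3,4)[OF x that] admissibleD(3,4)[OF y that] admissibleD(3,4)[OF z that]
    by (auto simp: val_median_point[OF that] med_def)
  show "val ?m a = 0 \<or> val ?m b = w b" if ab: "a \<preceq> b" "a \<noteq> b" for a b
  proof -
    have E: "a \<in> elts" "b \<in> elts" using prec_elts[OF ab(1)] .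
    have c: "val u a = 0 \<or> val u b = w b" if "admissible u" for u
      using that ab unfolding admissible_def by blast
    show ?thesis
      using c[OF x] c[OF y] c[OF z]
      by (elim disjE) (simp_all add: val_median_point E med_majority)
  qed
qed

text \<open>On a chain \<open>T\<close> with least element \<open>a\<close>, a point \<open>y\<close> that is as high as \<open>m\<close> at \<open>a\<close>, where \<open>m\<close> is positive,
  has full value on the rest of \<open>T\<close> and therefore dominates \<open>m\<close> on all of \<open>T\<close>.\<close>

lemma nested_bound_dominated:
  assumes x: "admissible x" and y: "admissible y" and m: "admissible m"
    and y_bound: "nested_bound x y r"
    and T: "nested T" "a \<in> T" "\<And>b. b \<in> T \<Longrightarrow> a \<preceq> b" and pos: "0 < val m a" and le: "val m a \<le> val y a"
  shows "(\<Sum>b\<in>T. gain x m b) \<le> r"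
proof -
  have "gain x m b \<le> gain x y b" if b: "b \<in> T" for b
  proof -
    have E: "b \<in> elts" using b T by (auto simp: nested_def)
    have "val m b \<le> val y b"
    proof (cases "b = a")
      case False
      then have "val y b = w b" using admissibleD(5)[OF y T(3)[OF b]] pos le by simp
      then show ?thesis using admissibleD(4)[OF m E] by simp
    qed (use le in simp)
    then show ?thesis by (simp add: gain_def)
  qed
  then have "(\<Sum>b\<in>T. gain x m b) \<le> (\<Sum>b\<in>T. gain x y b)" by (rule sum_mono)
  also have "\<dots> \<le> r" using y_bound T unfolding nested_bound_def by blast
  finally show ?thesis .
qed

lemma nested_bound_median_point:
  assumes adm: "admissible x" "admissible p" "admissible q" "admissible s"
    and p: "nested_bound x p r" and q: "nested_bound x q r"
  shows "nested_bound x (median_point p q s) r"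
  unfolding nested_bound_def
proof (intro allI impI)
  fix S assume S: "nested S"
  let ?m = "median_point p q s"
  have m: "admissible ?m" using admissible_median_point adm by blast
  define T where "T = {a \<in> S. val x a < val ?m a}"
  have T: "nested T" by (rule nested_subset[OF S]) (auto simp: T_def)
  have "(\<Sum>a\<in>S. gain x ?m a) = (\<Sum>a\<in>T. gain x ?m a)"
    using S by (intro sum.mono_neutral_right) (auto simp: T_def gain_def nested_def)
  also have "\<dots> \<le> r"
  proof (cases "T = {}")
    case True
    then show ?thesis using nested_bound_nonneg[OF p] by simp
  next
    case False
    obtain a where a: "a \<in> T" "\<forall>b\<in>T. a \<preceq> b" using nested_least[OF T False] by blast
    have E: "a \<in> elts" using a T by (auto simp: nested_def)
    have pos: "0 < val ?m a" using a admissibleD(3)[OF adm(1) E] by (auto simp: T_def)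
    have "val ?m a \<le> val p a \<or> val ?m a \<le> val q a"
      unfolding val_median_point[OF E] by (auto simp: med_def)
    then show ?thesis
      using nested_bound_dominated[OF adm(1,2) m p T a(1) _ pos]
        nested_bound_dominated[OF adm(1,3) m q T a(1) _ pos] a(2) by blast
  qed
  finally show "(\<Sum>a\<in>S. gain x ?m a) \<le> r" .
qed

lemma ball_ternary_convex:
  assumes x: "x \<in> pts"
  shows "ternary_convex median_point pts {y \<in> pts. dst x y \<le> r}"
  unfolding ternary_convex_def
proof (intro conjI ballI)
  fix p q s assume p: "p \<in> {y \<in> pts. dst x y \<le> r}" and q: "q \<in> {y \<in> pts. dst x y \<le> r}" and s: "s \<in> pts"
  have P: "p \<in> pts" "q \<in> pts" using p q by auto
  have adm: "admissible x" "admissible p" "admissible q" "admissible s"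
    using x P s by (auto simp: pts_iff)
  have m: "median_point p q s \<in> pts" using admissible_median_point adm by (simp add: pts_iff)
  have "nested_bound x p r" "nested_bound x q r"
    using nested_bound_mono[OF nested_bound_dst[OF x P(1)]] nested_bound_mono[OF nested_bound_dst[OF x P(2)]] p q
    by auto
  then have "dst x (median_point p q s) \<le> r"
    by (intro dst_le_nested_bound[OF x m] nested_bound_median_point adm)
  then show "median_point p q s \<in> {y \<in> pts. dst x y \<le> r}" using m by simp
qed blast

text \<open>The chain is walked along until the length \<open>r\<close> is used up; the last face is crossed along a
  segment.\<close>

lemma chain_split:
  assumes "face_chain P w B x y m z" "(\<Sum>i<m. sup_dist B (z (Suc i)) (z i)) \<le> r + s"
    and "0 \<le> r" "0 \<le> s" "x \<in> pts" "y \<in> pts"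
  shows "\<exists>u\<in>pts. dst x u \<le> r \<and> dst u y \<le> s"
  using assms
proof (induction m arbitrary: x z r)
  case 0
  interpret Metric_space pts dst by (rule Metric_space_pts)
  have "z 0 = x" "z 0 = y" using 0(1) by (auto simp: face_chain_def)
  then have "x = y" by simp
  then show ?case using 0 mdist_zero by (intro bexI[of _ x]) auto
next
  case (Suc m)
  interpret Metric_space pts dst by (rule Metric_space_pts)
  let ?x = "z (Suc 0)" and ?z = "\<lambda>i. z (Suc i)"
  let ?l = "sup_dist B ?x x" and ?R = "\<Sum>i<m. sup_dist B (?z (Suc i)) (?z i)"
  have z0: "z 0 = x" using Suc.prems(1) by (simp add: face_chain_def)
  have c: "face_chain P w B ?x y m ?z" using Suc.prems(1) by (auto simp: face_chain_def)
  obtain F where F: "F \<in> faces P w B" "x \<in> F" "?x \<in> F"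
    using Suc.prems(1) by (auto simp: face_chain_def)
  have x1: "?x \<in> pts" using F face_pts by blast
  have total: "?l + ?R \<le> r + s"
    using Suc.prems(2) unfolding sum.lessThan_Suc_shift z0 .
  have dx: "dst x ?x \<le> ?l" using dst_face_le[OF F] by (simp add: sup_dist_commute)
  show ?case
  proof (cases "?l \<le> r")
    case True
    have "\<exists>u\<in>pts. dst ?x u \<le> r - ?l \<and> dst u y \<le> s"
      by (rule Suc.IH[OF c]) (use True total Suc.prems x1 in auto)
    then obtain u where u: "u \<in> pts" "dst ?x u \<le> r - ?l" "dst u y \<le> s" by blast
    then show ?thesis using triangle[OF Suc.prems(5) x1 u(1)] dx by (intro bexI[of _ u]) auto
  next
    case False
    define t where "t = r / ?l"
    have lpos: "0 < ?l" using False Suc.prems(3) by simp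
    have t: "0 \<le> t" "t \<le> 1" "t * ?l = r" using False Suc.prems(3) lpos by (auto simp: t_def)
    define u where "u p = (1 - t) * x p + t * ?x p" for p
    have uF: "u \<in> F" unfolding u_def by (rule face_segment[OF F t(1,2)])
    have uX: "u \<in> pts" using face_pts[OF F(1) uF] .
    have coord: "\<bar>?x p - x p\<bar> \<le> ?l" if "p \<in> B" for p using le_sup_dist[OF poc base F(1,3,2) that] .
    have "sup_dist B x u \<le> r"
    proof (rule sup_dist_le)
      fix p assume p: "p \<in> B"
      have "x p - u p = - (t * (?x p - x p))" by (simp add: u_def algebra_simps)
      then have "\<bar>x p - u p\<bar> = t * \<bar>?x p - x p\<bar>" using t by (simp add: abs_mult)
      also have "\<dots> \<le> t * ?l" using coord[OF p] t(1) by (rule mult_left_mono)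
      finally show "\<bar>x p - u p\<bar> \<le> r" using t by simp
    qed
    then have 1: "dst x u \<le> r" using dst_face_le[OF F(1,2) uF] by simp
    have "sup_dist B u ?x \<le> ?l - r"
    proof (rule sup_dist_le)
      fix p assume p: "p \<in> B"
      have "u p - ?x p = - ((1 - t) * (?x p - x p))" by (simp add: u_def algebra_simps)
      then have "\<bar>u p - ?x p\<bar> = (1 - t) * \<bar>?x p - x p\<bar>" using t by (simp add: abs_mult)
      also have "\<dots> \<le> (1 - t) * ?l" using coord[OF p] t(2) by (intro mult_left_mono) auto
      finally show "\<bar>u p - ?x p\<bar> \<le> ?l - r" using t by (simp add: algebra_simps)
    qed
    then have "dst u ?x \<le> ?l - r" using dst_face_le[OF F(1) uF F(3)] by simp
    moreover have "dst ?x y \<le> ?R" by (rule dst_le_chain[OF x1 Suc.prems(6) c])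
    ultimately have "dst u y \<le> s" using triangle[OF uX x1 Suc.prems(6)] total by simp
    then show ?thesis using 1 uX by blast
  qed
qed

end

lemma almost_hyperconvex_cubing:
  assumes "cubing_data P w B"
  shows "almost_hyperconvex (cubing P w B) (cubing_dist P w B)"
proof -
  interpret weighted_cubing P w B by unfold_locales (rule assms)
  interpret Metric_space pts dst by (rule Metric_space_pts)
  show ?thesis
    unfolding almost_hyperconvex_def
  proof (intro allI impI)
    fix F :: "(('a \<Rightarrow> real) \<times> real) set" and \<epsilon> :: real
    assume F: "finite F" "F \<noteq> {}" "F \<subseteq> pts \<times> UNIV" and \<epsilon>: "0 < \<epsilon>"
      and close: "\<forall>(x, r)\<in>F. \<forall>(y, s)\<in>F. dst x y \<le> r + s"
    define C where "C i = {y \<in> pts. dst (fst i) y \<le> snd i + \<epsilon>}" for i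
    have mem: "fst i \<in> pts" if "i \<in> F" for i using F that by auto
    have close': "dst (fst i) (fst j) \<le> snd i + snd j" if "i \<in> F" "j \<in> F" for i j
      using close that by (force simp: case_prod_beta)
    have nn: "0 \<le> snd i" if "i \<in> F" for i
      using close'[OF that that] mdist_zero[OF mem[OF that]] by simp
    have "(\<Inter>i\<in>F. C i) \<noteq> {}"
    proof (rule ternary_convex_Helly[OF median_point_swap F(1,2)])
      show "ternary_convex median_point pts (C i)" if "i \<in> F" for i
        unfolding C_def by (rule ball_ternary_convex[OF mem[OF that]])
      fix i j assume ij: "i \<in> F" "j \<in> F"
      have "dst (fst i) (fst j) < (snd i + \<epsilon>) + (snd j + \<epsilon>)" using close'[OF ij] \<epsilon> by simp
      then obtain m z where c: "face_chain P w B (fst i) (fst j) m z"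
        "(\<Sum>k<m. sup_dist B (z (Suc k)) (z k)) < (snd i + \<epsilon>) + (snd j + \<epsilon>)"
        by (rule dst_less_chain[OF mem[OF ij(1)] mem[OF ij(2)]])
      have "\<exists>u\<in>pts. dst (fst i) u \<le> snd i + \<epsilon> \<and> dst u (fst j) \<le> snd j + \<epsilon>"
        using chain_split[OF c(1) less_imp_le[OF c(2)]] nn ij \<epsilon> mem by (simp add: add_nonneg_nonneg)
      then show "C i \<inter> C j \<noteq> {}" by (auto simp: C_def commute)
    qed
    then obtain z where "z \<in> (\<Inter>i\<in>F. C i)" by blast
    then have "z \<in> pts \<and> (\<forall>(x, r)\<in>F. dst x z \<le> r + \<epsilon>)" using F(2) by (force simp: C_def)
    then show "\<exists>z\<in>pts. \<forall>(x, r)\<in>F. dst x z \<le> r + \<epsilon>" by blast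
  qed
qed

section \<open>Injectivity of the limit\<close>

theorem mainTheorem1:
  fixes P :: "nat \<Rightarrow> 'p poc" and w :: "nat \<Rightarrow> 'p \<Rightarrow> real" and B :: "nat \<Rightarrow> 'p set"
    and b :: "nat \<Rightarrow> 'p \<Rightarrow> real"
    and X :: "'x set" and d :: "'x \<Rightarrow> 'x \<Rightarrow> real" and c :: 'x
  assumes "\<And>n. cubing_data (P n) (w n) (B n)"
    and "\<And>n. locally_finite_cubing (P n) (B n)"
    and "\<And>n. proper_metric_space (cubing (P n) (w n) (B n)) (cubing_dist (P n) (w n) (B n))"
    and "\<And>n. b n \<in> cubing (P n) (w n) (B n)"
    and "Metric_space X d" and "Metric_space.mcomplete X d" and "c \<in> X"
    and "pointed_GH_converges (\<lambda>n. cubing (P n) (w n) (B n))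
           (\<lambda>n. cubing_dist (P n) (w n) (B n)) b X d c"
  shows "injective_metric_space TYPE('a) TYPE('c) X d"
proof -
  have cubing: "Metric_space (cubing (P n) (w n) (B n)) (cubing_dist (P n) (w n) (B n))" for n
    by (rule Metric_space_cubing[OF assms(1)])
  interpret pointed_limit "\<lambda>n. cubing (P n) (w n) (B n)" "\<lambda>n. cubing_dist (P n) (w n) (B n)" b X d c
    by (rule pointed_limit.intro) (rule cubing assms(4,5,7,8))+
  have "almost_hyperconvex X d"
    by (rule limit_almost_hyperconvex) (rule almost_hyperconvex_cubing[OF assms(1)])
  moreover have "compactin X.mtopology (X.mcball x r)" for x r
    by (rule limit_compact_balls[OF assms(6,3)])
  ultimately have "hyperconvex X d" by (rule X.almost_hyperconvex_imp_hyperconvex[rotated])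
  then show ?thesis using assms(5,7) by (intro hyperconvex_imp_injective) auto
qed

end
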